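(* For any $\epsilon>0$, there exists a polynomial-time randomized $(1+\epsilon)$-approximation algorithm for the minimum spanning tree problem whose pointwise Lipschitz constant with respect to the unweighted mapping, at any input graph $G$ and weight vector $w$, is $O(\epsilon^{-1}n/\mathrm{opt})$, where $n$ is the number of vertices of $G$ and $\mathrm{opt}$ is the minimum weight of a spanning tree of $G$ with respect to $w$.
   Context: Minimum spanning tree problem: given a connected undirected graph $G=(V,E)$ and $w\in\mathbb{R}_{\geq0}^E$, output a spanning tree $T$ minimizing $\sum_{e\in T}w(e)$; a $(1+\epsilon)$-approximation outputs a spanning tree of weight at most $(1+\epsilon)\mathrm{opt}$. For distributions $\mathcal{F},\mathcal{F}'$ over edge sets, $\mathrm{EM}_\mathrm{u}(\mathcal{F},\mathcal{F}')=\min_{\mathcal{D}}\mathbb{E}_{(F,F')\sim\mathcal{D}}|F\triangle F'|$ over couplings $\mathcal{D}$. The pointwise Lipschitz constant of $\mathcal{A}$ on $G$ at $w$ with respect to the unweighted mapping is $\limsup_{w'\in\mathbb{R}_{\geq0}^E,\,w'\to w}\mathrm{EM}_\mathrm{u}(\mathcal{A}(G,w),\mathcal{A}(G,w'))/\|w-w'\|_1$. *)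

theory Defs
  imports "HOL-Probability.Probability"
begin

section \<open>Graphs, weights and spanning trees\<close>

text \<open>
  Finite simple undirected graphs. The vertex set is \<^term>\<open>{..<n}\<close>, so that a graph can serve as
  input of a machine; an edge is a two-element set of vertices.
\<close>

record graph =
  nverts :: nat
  edges :: "nat set set"

definition verts :: "graph \<Rightarrow> nat set" where
  "verts G = {..<nverts G}"

definition wf_graph :: "graph \<Rightarrow> bool" where
  "wf_graph G \<longleftrightarrow> (\<forall>e\<in>edges G. \<exists>u\<in>verts G. \<exists>v\<in>verts G. u \<noteq> v \<and> e = {u, v})"

definition adj :: "nat set set \<Rightarrow> (nat \<times> nat) set" where
  "adj F = {(u, v). {u, v} \<in> F}"

definition connects :: "nat set set \<Rightarrow> nat set \<Rightarrow> bool" where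
  "connects F V \<longleftrightarrow> (\<forall>u\<in>V. \<forall>v\<in>V. (u, v) \<in> (adj F)\<^sup>*)"

definition is_cycle :: "nat set set \<Rightarrow> nat list \<Rightarrow> bool" where
  "is_cycle F vs \<longleftrightarrow> 3 \<le> length vs \<and> distinct vs \<and>
     (\<forall>i. Suc i < length vs \<longrightarrow> {vs ! i, vs ! Suc i} \<in> F) \<and> {last vs, hd vs} \<in> F"

definition connected_graph :: "graph \<Rightarrow> bool" where
  "connected_graph G \<longleftrightarrow> wf_graph G \<and> 0 < nverts G \<and> connects (edges G) (verts G)"

definition spanning_tree :: "graph \<Rightarrow> nat set set \<Rightarrow> bool" where
  "spanning_tree G T \<longleftrightarrow> T \<subseteq> edges G \<and> connects T (verts G) \<and> (\<nexists>vs. is_cycle T vs)"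

type_synonym weights = "nat set \<Rightarrow> real"

text \<open>
  The nonnegative vectors indexed by the edges. All members agree outside the edge set, hence the
  topology of pointwise convergence restricted to this set is the Euclidean one.
\<close>

definition weight_space :: "graph \<Rightarrow> weights set" where
  "weight_space G = edges G \<rightarrow>\<^sub>E {0..}"

definition weight :: "weights \<Rightarrow> nat set set \<Rightarrow> real" where
  "weight w T = (\<Sum>e\<in>T. w e)"

definition opt :: "graph \<Rightarrow> weights \<Rightarrow> real" where
  "opt G w = Min (weight w ` {T. spanning_tree G T})"

section \<open>Randomized algorithms and their pointwise Lipschitz constant\<close>

type_synonym algorithm = "graph \<Rightarrow> weights \<Rightarrow> nat set set pmf"

definition approximates_mst :: "real \<Rightarrow> algorithm \<Rightarrow> bool" where
  "approximates_mst \<alpha> A \<longleftrightarrow>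
     (\<forall>G w. connected_graph G \<longrightarrow> w \<in> weight_space G \<longrightarrow>
        (\<forall>T\<in>set_pmf (A G w). spanning_tree G T \<and> weight w T \<le> \<alpha> * opt G w))"

definition couplings :: "'a pmf \<Rightarrow> 'b pmf \<Rightarrow> ('a \<times> 'b) pmf set" where
  "couplings p q = {D. map_pmf fst D = p \<and> map_pmf snd D = q}"

definition EM_u :: "'a set pmf \<Rightarrow> 'a set pmf \<Rightarrow> ennreal" where
  "EM_u p q = (INF D\<in>couplings p q. \<integral>\<^sup>+ (F, F'). of_nat (card (sym_diff F F')) \<partial>measure_pmf D)"

definition l1_dist :: "graph \<Rightarrow> weights \<Rightarrow> weights \<Rightarrow> real" where
  "l1_dist G w w' = (\<Sum>e\<in>edges G. \<bar>w e - w' e\<bar>)"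

definition pointwise_lipschitz_u :: "algorithm \<Rightarrow> graph \<Rightarrow> weights \<Rightarrow> ennreal" where
  "pointwise_lipschitz_u A G w =
     Limsup (at w within weight_space G)
       (\<lambda>w'. EM_u (A G w) (A G w') / ennreal (l1_dist G w w'))"

section \<open>Randomized real RAM\<close>

text \<open>
  The standard real RAM, presented as a structured language. The memory consists of arrays of
  natural numbers and arrays of reals, both addressed by natural numbers (array name, index).
  Naturals admit only addition and truncated subtraction, so that unit cost is polynomially
  equivalent to bit cost; reals admit exact field arithmetic and comparison, but no rounding;
  the only real constants are rational. \<open>Sample\<close> stores a fresh uniform real from the unit interval.
\<close>

datatype nexp = NLit nat | NArr nat nexp | NPlus nexp nexp | NMinus nexp nexp

datatype rexp = RLit rat | RArr nat nexp | ROfNat nexp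
  | RPlus rexp rexp | RMinus rexp rexp | RTimes rexp rexp | RDiv rexp rexp

datatype bexp = NLess nexp nexp | RLess rexp rexp | BNot bexp | BAnd bexp bexp

datatype com = Skip
  | NAssign nat nexp nexp
  | RAssign nat nexp rexp
  | Sample nat nexp
  | Seq com com
  | Cond bexp com com
  | While bexp com

record state =
  nats :: "nat \<Rightarrow> nat \<Rightarrow> nat"
  reals :: "nat \<Rightarrow> nat \<Rightarrow> real"
  used :: nat \<comment> \<open>number of random reals consumed so far\<close>

fun nval :: "nexp \<Rightarrow> state \<Rightarrow> nat" where
  "nval (NLit k) s = k"
| "nval (NArr a i) s = nats s a (nval i s)"
| "nval (NPlus x y) s = nval x s + nval y s"
| "nval (NMinus x y) s = nval x s - nval y s"

fun rval :: "rexp \<Rightarrow> state \<Rightarrow> real" where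
  "rval (RLit q) s = of_rat q"
| "rval (RArr a i) s = reals s a (nval i s)"
| "rval (ROfNat x) s = real (nval x s)"
| "rval (RPlus x y) s = rval x s + rval y s"
| "rval (RMinus x y) s = rval x s - rval y s"
| "rval (RTimes x y) s = rval x s * rval y s"
| "rval (RDiv x y) s = rval x s / rval y s"

fun bval :: "bexp \<Rightarrow> state \<Rightarrow> bool" where
  "bval (NLess x y) s \<longleftrightarrow> nval x s < nval y s"
| "bval (RLess x y) s \<longleftrightarrow> rval x s < rval y s"
| "bval (BNot b) s \<longleftrightarrow> \<not> bval b s"
| "bval (BAnd b c) s \<longleftrightarrow> bval b s \<and> bval c s"

definition store :: "('a \<Rightarrow> nat \<Rightarrow> 'b) \<Rightarrow> 'a \<Rightarrow> nat \<Rightarrow> 'b \<Rightarrow> ('a \<Rightarrow> nat \<Rightarrow> 'b)" where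
  "store m a i x = m(a := (m a)(i := x))"

text \<open>
  \<open>exec \<omega> c s t s'\<close>: with the random reals \<open>\<omega>\<close>, command \<open>c\<close> takes state \<open>s\<close> to \<open>s'\<close> in time \<open>t\<close>.
  Atomic commands and tests have unit cost: the expressions of a fixed program have bounded size.
\<close>

inductive exec :: "(nat \<Rightarrow> real) \<Rightarrow> com \<Rightarrow> state \<Rightarrow> nat \<Rightarrow> state \<Rightarrow> bool" for \<omega> where
  Skip: "exec \<omega> Skip s 1 s"
| NAssign: "exec \<omega> (NAssign a i x) s 1 (s\<lparr>nats := store (nats s) a (nval i s) (nval x s)\<rparr>)"
| RAssign: "exec \<omega> (RAssign a i x) s 1 (s\<lparr>reals := store (reals s) a (nval i s) (rval x s)\<rparr>)"
| Sample: "exec \<omega> (Sample a i) s 1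
    (s\<lparr>reals := store (reals s) a (nval i s) (\<omega> (used s)), used := Suc (used s)\<rparr>)"
| Seq: "exec \<omega> c s t s' \<Longrightarrow> exec \<omega> d s' t' s'' \<Longrightarrow> exec \<omega> (Seq c d) s (t + t') s''"
| CondTrue: "bval b s \<Longrightarrow> exec \<omega> c s t s' \<Longrightarrow> exec \<omega> (Cond b c d) s (Suc t) s'"
| CondFalse: "\<not> bval b s \<Longrightarrow> exec \<omega> d s t s' \<Longrightarrow> exec \<omega> (Cond b c d) s (Suc t) s'"
| WhileFalse: "\<not> bval b s \<Longrightarrow> exec \<omega> (While b c) s 1 s"
| WhileTrue: "bval b s \<Longrightarrow> exec \<omega> c s t s' \<Longrightarrow> exec \<omega> (While b c) s' t' s'' \<Longrightarrow>
    exec \<omega> (While b c) s (Suc (t + t')) s''"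

text \<open>
  Input: array 0 of the naturals holds the numbers of vertices and of edges at indices 0 and 1,
  arrays 1 and 2 hold the two endpoints of the \<open>k\<close>-th edge in lexicographic order, and array 0 of
  the reals holds its weight; all other cells are 0. Output: the \<open>k\<close>-th edge is selected iff
  array 3 of the naturals has a nonzero entry at index \<open>k\<close>.
\<close>

definition edge_list :: "graph \<Rightarrow> (nat \<times> nat) list" where
  "edge_list G = [(u, v). u \<leftarrow> [0..<nverts G], v \<leftarrow> [Suc u..<nverts G], {u, v} \<in> edges G]"

definition edge_at :: "graph \<Rightarrow> nat \<Rightarrow> nat set" where
  "edge_at G k = {fst (edge_list G ! k), snd (edge_list G ! k)}"

definition input_state :: "graph \<Rightarrow> weights \<Rightarrow> state" where
  "input_state G w = (let es = edge_list G; m = length es in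
     \<lparr>nats = (\<lambda>a k.
        if a = 0 \<and> k = 0 then nverts G
        else if a = 0 \<and> k = 1 then m
        else if a = 1 \<and> k < m then fst (es ! k)
        else if a = 2 \<and> k < m then snd (es ! k)
        else 0),
      reals = (\<lambda>a k. if a = 0 \<and> k < m then w (edge_at G k) else 0),
      used = 0\<rparr>)"

definition output_edges :: "graph \<Rightarrow> state \<Rightarrow> nat set set" where
  "output_edges G s = {edge_at G k |k. k < length (edge_list G) \<and> nats s 3 k \<noteq> 0}"

definition random_tape :: "(nat \<Rightarrow> real) measure" where
  "random_tape = (\<Pi>\<^sub>M i\<in>UNIV. restrict_space lborel {0..1})"

definition final_state :: "com \<Rightarrow> graph \<Rightarrow> weights \<Rightarrow> (nat \<Rightarrow> real) \<Rightarrow> state" where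
  "final_state P G w \<omega> = (THE s. \<exists>t. exec \<omega> P (input_state G w) t s)"

definition run_output :: "com \<Rightarrow> graph \<Rightarrow> weights \<Rightarrow> (nat \<Rightarrow> real) \<Rightarrow> nat set set" where
  "run_output P G w \<omega> = output_edges G (final_state P G w \<omega>)"

definition implements :: "com \<Rightarrow> algorithm \<Rightarrow> bool" where
  "implements P A \<longleftrightarrow>
     (\<forall>G w. connected_graph G \<longrightarrow> w \<in> weight_space G \<longrightarrow>
        run_output P G w \<in> random_tape \<rightarrow>\<^sub>M count_space UNIV \<and>
        distr random_tape (count_space UNIV) (run_output P G w) = measure_pmf (A G w))"

definition runs_in_poly_time :: "com \<Rightarrow> bool" where
  "runs_in_poly_time P \<longleftrightarrow>
     (\<exists>c d. \<forall>G w. connected_graph G \<longrightarrow> w \<in> weight_space G \<longrightarrow>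
        (\<forall>\<omega>\<in>space random_tape. \<exists>t s. exec \<omega> P (input_state G w) t s \<and>
           t \<le> c * (nverts G + card (edges G)) ^ d))"

definition poly_time_algorithm :: "algorithm \<Rightarrow> bool" where
  "poly_time_algorithm A \<longleftrightarrow> (\<exists>P. runs_in_poly_time P \<and> implements P A)"

end

theory Submission
  imports Defs
begin

text \<open>
  Draw a grid width \<open>s\<close> uniformly from \<open>[a, 2a]\<close>, where \<open>a = opt / (N n)\<close> and \<open>N\<close> is about \<open>2 / \<epsilon>\<close>, round
  every weight up to a multiple of \<open>s\<close>, and output the minimum spanning tree of the rounded weights,
  ties being broken by the index of the edge. Rounding costs at most \<open>s\<close> per tree edge, hence at most
  \<open>n s \<le> \<epsilon> opt\<close> in total.

  If \<open>w\<close> moves to a nearby \<open>w'\<close>, the widths of both runs can be coupled to coincide except with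
  probability \<open>O(\<parallel>w - w'\<parallel> / opt)\<close>, because \<open>opt\<close> is 1-Lipschitz; on the exceptional event at most \<open>2n\<close>
  edges differ. For equal widths, the tree changes by at most four edges per edge whose rounded weight
  changes: compare both trees with the one of the graph without these edges. An edge \<open>e\<close> changes its rounded
  weight with probability \<open>O(\<bar>w e - w' e\<bar> / a)\<close>, since randomness of \<open>s\<close> alone moves all grid lines \<open>k s\<close>.
\<close>

section \<open>Components, forests and Kruskal's tree\<close>

text \<open>The width is squeezed from both sides. A tree has n - 1 edges and each may lose one
  width, so accuracy asks for \<open>s\<close> of order \<epsilon> opt / n; a weight crosses a grid
  line with probability proportional to 1 / s. The factor n / (\<epsilon> opt) is this 1 / s. The
  number of edges does not enter, because the crossing probabilities add up to the l1 distance.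

  The machine has no rounding and is not given \<open>opt\<close>. A greedy pass on the exact
  weights supplies \<open>opt\<close>, and a rounded weight is represented by the number of grid
  lines strictly below it, found by comparisons. Weights may be huge compared with
  \<open>opt\<close>, so this count is cut off at N n + 1 to keep the time polynomial; the tree that
  minimises the total count never reaches the cut-off.

  As the width scales with \<open>opt\<close>, the widths of the two runs are uniform on different
  intervals. Only the overlap is coupled explicitly. If \<open>opt\<close> is 0, the width is 0 and
  the claimed Lipschitz bound is infinite, so only the approximation guarantee needs an
  argument.\<close>

definition labels :: "(nat \<Rightarrow> 'a) \<Rightarrow> nat set set \<Rightarrow> nat set \<Rightarrow> bool" where
  "labels f F V \<longleftrightarrow> (\<forall>x\<in>V. \<forall>y\<in>V. f x = f y \<longleftrightarrow> (x, y) \<in> (adj F)\<^sup>*)"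

definition comps :: "nat set set \<Rightarrow> nat set \<Rightarrow> nat" where
  "comps F V = card ((\<lambda>v. (adj F)\<^sup>* `` {v}) ` V)"

definition edges_on :: "nat set \<Rightarrow> nat set set \<Rightarrow> bool" where
  "edges_on V F \<longleftrightarrow> (\<forall>e\<in>F. \<exists>u\<in>V. \<exists>v\<in>V. u \<noteq> v \<and> e = {u, v})"

definition joined :: "nat set set \<Rightarrow> nat set \<Rightarrow> bool" where
  "joined F e \<longleftrightarrow> (\<exists>u v. e = {u, v} \<and> (u, v) \<in> (adj F)\<^sup>*)"

text \<open>Each edge is tested against all smaller edges, not only the accepted ones. Accepted
  edges preserve connectivity (\<open>kruskal_spans\<close>), so this agrees with the sequential
  greedy rule. Every decision is now independent of the others, which makes the effect of deleting
  edges a matter of monotonicity.\<close>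

definition kruskal :: "(nat set \<Rightarrow> nat set \<Rightarrow> bool) \<Rightarrow> nat set set \<Rightarrow> nat set set" where
  "kruskal lt F = {e \<in> F. \<not> joined {f \<in> F. lt f e} e}"

section \<open>Connectivity, component counts and edge insertion\<close>

lemma conn_sym: "(x, y) \<in> (adj F)\<^sup>* \<Longrightarrow> (y, x) \<in> (adj F)\<^sup>*"
  by (rule symD[OF sym_rtrancl]) (auto simp: sym_def adj_def insert_commute)

lemma conn_mono: "F \<subseteq> F' \<Longrightarrow> (adj F)\<^sup>* \<subseteq> (adj F')\<^sup>*"
  by (rule rtrancl_mono) (auto simp: adj_def)

lemma joined_doubleton: "joined F {u, v} \<longleftrightarrow> (u, v) \<in> (adj F)\<^sup>*"
  unfolding joined_def by (metis conn_sym doubleton_eq_iff)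

lemma joined_mono: "F \<subseteq> F' \<Longrightarrow> joined F e \<Longrightarrow> joined F' e"
  using conn_mono unfolding joined_def by blast

lemma conn_insert:
  "(x, y) \<in> (adj (insert {u, v} F))\<^sup>* \<longleftrightarrow> (x, y) \<in> (adj F)\<^sup>* \<or>
     (x, u) \<in> (adj F)\<^sup>* \<and> (v, y) \<in> (adj F)\<^sup>* \<or> (x, v) \<in> (adj F)\<^sup>* \<and> (u, y) \<in> (adj F)\<^sup>*"
proof -
  have "adj (insert {u, v} F) = insert (u, v) (insert (v, u) (adj F))"
    by (auto simp: adj_def doubleton_eq_iff)
  then show ?thesis
    by (auto simp: rtrancl_insert intro: rtrancl_trans)
qed

lemma conn_insert_joined:
  assumes "joined F e" shows "(adj (insert e F))\<^sup>* = (adj F)\<^sup>*"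
proof
  obtain u v where e: "e = {u, v}" "(u, v) \<in> (adj F)\<^sup>*" using assms by (auto simp: joined_def)
  have vu: "(v, u) \<in> (adj F)\<^sup>*" using e(2) by (rule conn_sym)
  show "(adj (insert e F))\<^sup>* \<subseteq> (adj F)\<^sup>*"
  proof
    fix p assume "p \<in> (adj (insert e F))\<^sup>*"
    then obtain x y where p: "p = (x, y)" "(x, y) \<in> (adj (insert {u, v} F))\<^sup>*"
      using e by (cases p) auto
    from p(2) consider "(x, y) \<in> (adj F)\<^sup>*" | "(x, u) \<in> (adj F)\<^sup>*" "(v, y) \<in> (adj F)\<^sup>*"
      | "(x, v) \<in> (adj F)\<^sup>*" "(u, y) \<in> (adj F)\<^sup>*" unfolding conn_insert by blast
    then show "p \<in> (adj F)\<^sup>*"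
      unfolding p(1) by cases (use e(2) vu in \<open>metis rtrancl_trans\<close>)+
  qed
qed (rule conn_mono, auto)

lemma labels_class: "labels (\<lambda>v. (adj F)\<^sup>* `` {v}) F V"
  unfolding labels_def
  by (auto simp: set_eq_iff intro: rtrancl_trans conn_sym)

lemma card_image_kernel:
  assumes "\<And>x y. x \<in> V \<Longrightarrow> y \<in> V \<Longrightarrow> f x = f y \<longleftrightarrow> g x = g y"
  shows "card (f ` V) = card (g ` V)"
proof (rule bij_betw_same_card)
  show "bij_betw (\<lambda>z. g (SOME x. x \<in> V \<and> f x = z)) (f ` V) (g ` V)"
  proof -
    have *: "g (SOME y. y \<in> V \<and> f y = f x) = g x" if "x \<in> V" for x
      using someI[of "\<lambda>y. y \<in> V \<and> f y = f x" x] that assms by blast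
    show ?thesis
      unfolding bij_betw_def inj_on_def
      by (auto simp: * assms image_iff)
  qed
qed

lemma card_labels: "labels f F V \<Longrightarrow> card (f ` V) = comps F V"
  unfolding comps_def using labels_class[of F V]
  by (intro card_image_kernel) (auto simp: labels_def)

text \<open>Two components merge when one label overwrites the other. The relabelling counts the
  component lost by an insertion, and it is also what the loop of \<open>merge_labels\<close> does
  on the machine.\<close>

lemma labels_insert:
  assumes "labels f F V" "u \<in> V" "v \<in> V"
  shows "labels (\<lambda>x. if f x = f v then f u else f x) (insert {u, v} F) V"
proof -
  have *: "(x, y) \<in> (adj F)\<^sup>* \<longleftrightarrow> f x = f y" if "x \<in> V" "y \<in> V" for x y
    using assms that by (simp add: labels_def)
  show ?thesis
    unfolding labels_def
  proof (intro ballI)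
    fix x y assume "x \<in> V" "y \<in> V"
    then show "((if f x = f v then f u else f x) = (if f y = f v then f u else f y)) \<longleftrightarrow>
        (x, y) \<in> (adj (insert {u, v} F))\<^sup>*"
      unfolding conn_insert using assms(2,3) by (simp add: *)
  qed
qed

lemma card_image_merge:
  assumes "finite V" "u \<in> V" "v \<in> V" "f u \<noteq> f v"
  shows "card (f ` V) = Suc (card ((\<lambda>x. if f x = f v then f u else f x) ` V))"
proof -
  have "(\<lambda>x. if f x = f v then f u else f x) ` V = f ` V - {f v}"
    using assms(2,4) by (auto simp: image_iff)
  then show ?thesis
    using assms card.remove[of "f ` V" "f v"] by simp
qed

lemma comps_insert:
  assumes "finite V" "u \<in> V" "v \<in> V" "\<not> joined F {u, v}"
  shows "comps F V = Suc (comps (insert {u, v} F) V)"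
proof -
  obtain f :: "nat \<Rightarrow> nat set" where f: "labels f F V" using labels_class by blast
  then have "f u \<noteq> f v" using assms by (simp add: labels_def joined_doubleton)
  from card_image_merge[of V u v f, OF assms(1-3) this]
  show ?thesis using card_labels[OF f] card_labels[OF labels_insert[OF f assms(2,3)]] by simp
qed

lemma comps_insert_joined: "joined F e \<Longrightarrow> comps (insert e F) V = comps F V"
  unfolding comps_def by (simp add: conn_insert_joined)

text \<open>Closing a component of \<open>F\<close> under \<open>F'\<close> gives a component of
  \<open>F'\<close>, so the components of \<open>F'\<close> are an image of those of
  \<open>F\<close>.\<close>

lemma comps_mono:
  assumes "finite V" "F \<subseteq> F'" shows "comps F' V \<le> comps F V"
proof -
  have "(adj F')\<^sup>* `` {v} = (adj F')\<^sup>* `` ((adj F)\<^sup>* `` {v})" for v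
    using conn_mono[OF assms(2)] by (auto intro: rtrancl_trans)
  then have "(\<lambda>v. (adj F')\<^sup>* `` {v}) ` V = (\<lambda>C. (adj F')\<^sup>* `` C) ` (\<lambda>v. (adj F)\<^sup>* `` {v}) ` V"
    by (auto simp: image_image)
  then show ?thesis
    unfolding comps_def using card_image_le[of "(\<lambda>v. (adj F)\<^sup>* `` {v}) ` V"] assms(1) by simp
qed

lemma comps_empty: "comps {} V = card V"
proof -
  have "labels (\<lambda>x. x) {} V" by (simp add: labels_def adj_def)
  from card_labels[OF this] show ?thesis by simp
qed

lemma comps_connects:
  assumes "connects F V" "V \<noteq> {}" shows "comps F V = 1"
proof -
  have "labels (\<lambda>x. ()) F V" using assms by (auto simp: labels_def connects_def)
  from card_labels[OF this] have "comps F V = card ((\<lambda>x. ()) ` V)" by simp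
  also have "(\<lambda>x. ()) ` V = {()}" using assms by auto
  finally show ?thesis by simp
qed

lemma card_ge_comps:
  assumes "finite F" "finite V" "edges_on V F"
  shows "card V \<le> card F + comps F V"
  using assms(1,3)
proof (induction F rule: finite_induct)
  case empty then show ?case by (simp add: comps_empty)
next
  case (insert e F)
  then obtain u v where e: "u \<in> V" "v \<in> V" "e = {u, v}" by (auto simp: edges_on_def)
  have "card V \<le> card F + comps F V" using insert by (auto simp: edges_on_def)
  then show ?case
    using comps_insert[OF assms(2) e(1,2), of F] comps_insert_joined[of F e V] e insert
    by (cases "joined F e") auto
qed

section \<open>Paths, cycles and the size of forests\<close>

lemma conn_imp_path:
  assumes "(u, v) \<in> (adj F)\<^sup>*"
  shows "\<exists>vs. vs \<noteq> [] \<and> distinct vs \<and> hd vs = u \<and> last vs = v \<and>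
    (\<forall>i. Suc i < length vs \<longrightarrow> {vs ! i, vs ! Suc i} \<in> F)"
  using assms
proof (induction rule: rtrancl_induct)
  case base show ?case by (rule exI[of _ "[u]"]) simp
next
  case (step y z)
  then obtain vs where vs: "vs \<noteq> []" "distinct vs" "hd vs = u" "last vs = y"
    "\<And>i. Suc i < length vs \<Longrightarrow> {vs ! i, vs ! Suc i} \<in> F" by blast
  show ?case
  proof (cases "z \<in> set vs")
    \<comment> \<open>The walk returns to a visited vertex: cutting the path there keeps it simple
      and makes it end at \<open>z\<close>.\<close>
    case True
    then obtain k where k: "k < length vs" "vs ! k = z" by (auto simp: in_set_conv_nth)
    then have "length (take (Suc k) vs) = Suc k" by simp
    moreover from this k have "last (take (Suc k) vs) = z"
      by (metis Zero_not_Suc diff_Suc_1 last_conv_nth lessI list.size(3) nth_take)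
    ultimately show ?thesis
      using vs k by (intro exI[of _ "take (Suc k) vs"]) (auto simp: hd_take)
  next
    case False
    have "{(vs @ [z]) ! i, (vs @ [z]) ! Suc i} \<in> F" if i: "Suc i < length (vs @ [z])" for i
    proof (cases "Suc i < length vs")
      case True then show ?thesis using vs(5) by (simp add: nth_append)
    next
      case f: False
      then have "i = length vs - 1" "i < length vs" using i vs(1) by auto
      then show ?thesis using vs(1,4) step(2)
        by (simp add: nth_append last_conv_nth adj_def)
    qed
    then show ?thesis using vs False by (intro exI[of _ "vs @ [z]"]) auto
  qed
qed

lemma path_imp_conn:
  assumes "vs \<noteq> []" "\<And>i. Suc i < length vs \<Longrightarrow> {vs ! i, vs ! Suc i} \<in> F"
  shows "(hd vs, last vs) \<in> (adj F)\<^sup>*"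
proof -
  have "(vs ! 0, vs ! i) \<in> (adj F)\<^sup>*" if "i < length vs" for i
    using that
  proof (induction i)
    case (Suc i)
    then show ?case using assms(2)[of i] by (auto simp: adj_def intro: rtrancl_into_rtrancl)
  qed simp
  then show ?thesis using assms(1) by (simp add: hd_conv_nth last_conv_nth)
qed

text \<open>An edge inside a component would close a cycle with the simple path between its ends, so
  every edge of a forest lowers the component count by exactly one.\<close>

lemma acyclic_card:
  assumes "finite F" "finite V" "edges_on V F" "\<nexists>vs. is_cycle F vs"
  shows "card F + comps F V = card V"
  using assms(1,3,4)
proof (induction F rule: finite_induct)
  case empty then show ?case by (simp add: comps_empty)
next
  case (insert e F)
  then obtain u v where e: "u \<in> V" "v \<in> V" "u \<noteq> v" "e = {u, v}" by (auto simp: edges_on_def)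
  have "\<nexists>vs. is_cycle F vs" using insert.prems unfolding is_cycle_def by blast
  then have IH: "card F + comps F V = card V" using insert by (auto simp: edges_on_def)
  have "\<not> joined F e"
  proof
    assume "joined F e"
    then have "(u, v) \<in> (adj F)\<^sup>*" using e by (simp add: joined_doubleton)
    from conn_imp_path[OF this] obtain vs where vs: "vs \<noteq> []" "distinct vs" "hd vs = u" "last vs = v"
      "\<And>i. Suc i < length vs \<Longrightarrow> {vs ! i, vs ! Suc i} \<in> F" by blast
    \<comment> \<open>\<open>is_cycle\<close> demands three vertices. A path with only two would be
      the edge \<open>e\<close> itself, which is not in \<open>F\<close>.\<close>
    have "3 \<le> length vs"
    proof (rule ccontr)
      assume "\<not> 3 \<le> length vs"
      moreover have "length vs \<noteq> 1" using vs e by (auto simp: hd_conv_nth last_conv_nth)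
      moreover have "length vs \<noteq> 0" using vs by simp
      ultimately have "length vs = 2" by linarith
      then have "{u, v} \<in> F" using vs(1,3,4) vs(5)[of 0] by (simp add: hd_conv_nth last_conv_nth)
      then show False using insert e by simp
    qed
    then have "is_cycle (insert e F) vs" using vs e by (auto simp: is_cycle_def insert_commute)
    then show False using insert.prems by blast
  qed
  then show ?case using IH comps_insert[OF assms(2) e(1,2), of F] e insert by auto
qed

text \<open>Removing an edge of a cycle keeps the components but lowers the number of edges, against
  the bound \<open>card_ge_comps\<close>.\<close>

lemma card_acyclic:
  assumes "finite F" "finite V" "edges_on V F" "card F + comps F V = card V"
  shows "\<nexists>vs. is_cycle F vs"
proof
  assume "\<exists>vs. is_cycle F vs"
  then obtain vs where vs: "3 \<le> length vs" "distinct vs"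
    "\<And>i. Suc i < length vs \<Longrightarrow> {vs ! i, vs ! Suc i} \<in> F" "{last vs, hd vs} \<in> F"
    by (auto simp: is_cycle_def)
  let ?e = "{last vs, hd vs}" and ?F = "F - {{last vs, hd vs}}"
  have ne: "vs \<noteq> []" using vs by auto
  \<comment> \<open>With at least three distinct vertices the closing edge is not among the edges of
    the path, so the path survives its removal.\<close>
  have "{vs ! i, vs ! Suc i} \<noteq> ?e" if "Suc i < length vs" for i
  proof
    assume "{vs ! i, vs ! Suc i} = ?e"
    then have "vs ! Suc i = last vs \<and> vs ! i = hd vs \<or> vs ! i = last vs \<and> vs ! Suc i = hd vs"
      by (auto simp: doubleton_eq_iff)
    then have "(Suc i = length vs - 1 \<and> i = 0) \<or> (Suc i = 0)"
      using vs(1,2) that ne nth_eq_iff_index_eq[OF vs(2)]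
      by (auto simp: hd_conv_nth last_conv_nth)
    then show False using vs(1) by auto
  qed
  then have "(hd vs, last vs) \<in> (adj ?F)\<^sup>*" using vs ne by (intro path_imp_conn) auto
  then have "joined ?F ?e" by (simp add: joined_doubleton conn_sym)
  then have "comps F V = comps ?F V" using comps_insert_joined[of ?F ?e V] vs(4)
    by (simp add: insert_absorb)
  moreover have "card V \<le> card ?F + comps ?F V"
    using assms by (intro card_ge_comps) (auto simp: edges_on_def)
  moreover have "card F = Suc (card ?F)" using vs(4) assms(1) by (metis card.remove)
  ultimately show False using assms(4) by simp
qed

section \<open>Kruskal's tree: rank, deletion and minimality\<close>

definition strict_order_on :: "nat set set \<Rightarrow> (nat set \<Rightarrow> nat set \<Rightarrow> bool) \<Rightarrow> bool" where
  "strict_order_on E lt \<longleftrightarrow> transp_on E lt \<and> asymp_on E lt \<and> totalp_on E lt"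

text \<open>The induction removes the largest edge, which lies below no other edge and so influences
  no other decision. The equation says that the accepted edges number the rank of \<open>F\<close>
  in the graphic matroid; the deletion and minimality arguments count with it.\<close>

lemma kruskal_spans:
  assumes "finite F" "finite V" "edges_on V F" "strict_order_on F lt"
  shows "(adj (kruskal lt F))\<^sup>* = (adj F)\<^sup>* \<and> card (kruskal lt F) + comps F V = card V"
  using assms(1,3,4)
proof (induction "card F" arbitrary: F)
  case 0
  then show ?case by (simp add: kruskal_def comps_empty)
next
  case (Suc k)
  have ord: "transp_on F lt" "asymp_on F lt" "totalp_on F lt"
    using Suc.prems by (auto simp: strict_order_on_def)
  have "F \<noteq> {}" using Suc by auto
  from Finite_Set.bex_max_element[OF Suc.prems(1) ord(2,1) this]
  obtain e where e: "e \<in> F" "\<And>x. x \<in> F \<Longrightarrow> x \<noteq> e \<Longrightarrow> \<not> lt e x" by blast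
  define F' where "F' = F - {e}"
  have F: "F = insert e F'" "finite F'" "e \<notin> F'" using e Suc by (auto simp: F'_def)
  obtain u v where uv: "u \<in> V" "v \<in> V" "e = {u, v}"
    using Suc.prems(2) e by (auto simp: edges_on_def)
  have "k = card F'" using Suc.hyps(2) F by simp
  moreover have "edges_on V F'" "strict_order_on F' lt"
    using Suc.prems ord by (auto simp: F'_def edges_on_def strict_order_on_def
        intro: transp_on_subset asymp_on_subset totalp_on_subset)
  ultimately have IH: "(adj (kruskal lt F'))\<^sup>* = (adj F')\<^sup>*" "card (kruskal lt F') + comps F' V = card V"
    using Suc.hyps(1)[of F'] F(2) by auto
  have irr: "\<not> lt e e" using asymp_onD[OF ord(2) e(1) e(1)] by blast
  have below: "{f \<in> F. lt f e} = F'"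
    using e irr totalp_onD[OF ord(3) _ e(1)] by (auto simp: F'_def)
  have m1: "f \<in> kruskal lt F \<longleftrightarrow> f \<in> kruskal lt F'" if "f \<in> F'" for f
  proof -
    have "{g \<in> F. lt g f} = {g \<in> F'. lt g f}" using that e by (auto simp: F'_def)
    then show ?thesis using that F by (simp add: kruskal_def)
  qed
  have m2: "e \<in> kruskal lt F \<longleftrightarrow> \<not> joined F' e" using e(1) below by (simp add: kruskal_def)
  have m3: "kruskal lt F' \<subseteq> F'" "kruskal lt F \<subseteq> insert e F'" using F by (auto simp: kruskal_def)
  have kr: "kruskal lt F = (if joined F' e then kruskal lt F' else insert e (kruskal lt F'))"
  proof (rule set_eqI)
    fix f
    consider "f = e" | "f \<in> F'" "f \<noteq> e" | "f \<notin> F'" "f \<noteq> e" by blast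
    then show "f \<in> kruskal lt F \<longleftrightarrow> f \<in> (if joined F' e then kruskal lt F' else insert e (kruskal lt F'))"
      using m1 m2 m3 F(3) by cases auto
  qed
  have nin: "e \<notin> kruskal lt F'" using F by (simp add: kruskal_def)
  have fin: "finite (kruskal lt F')" using F by (simp add: kruskal_def)
  show ?case
  proof (cases "joined F' e")
    case True
    then show ?thesis using kr IH conn_insert_joined[OF True] comps_insert_joined[OF True, of V] F(1)
      by simp
  next
    case False
    have "p \<in> (adj (insert {u, v} (kruskal lt F')))\<^sup>* \<longleftrightarrow> p \<in> (adj (insert {u, v} F'))\<^sup>*" for p
      by (cases p) (simp only: conn_insert IH(1))
    then have "(adj (insert e (kruskal lt F')))\<^sup>* = (adj (insert e F'))\<^sup>*"
      unfolding uv(3) by (rule set_eqI)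
    then have "(adj (kruskal lt F))\<^sup>* = (adj F)\<^sup>*"
      unfolding F(1)[symmetric] using kr False by simp
    moreover have "card (kruskal lt F) = Suc (card (kruskal lt F'))"
      using kr False nin fin by simp
    moreover have "comps F' V = Suc (comps F V)"
      using comps_insert[OF assms(2) uv(1,2), of F'] False uv F(1) by simp
    ultimately show ?thesis using IH by simp
  qed
qed

lemma kruskal_subset: "kruskal lt F \<subseteq> F" by (auto simp: kruskal_def)

text \<open>A downward closed set decides its own edges. It is applied to the edges with key below a
  threshold.\<close>

lemma kruskal_initial:
  assumes "F \<subseteq> E" "\<And>e f. f \<in> F \<Longrightarrow> e \<in> E \<Longrightarrow> lt e f \<Longrightarrow> e \<in> F"
  shows "kruskal lt F = kruskal lt E \<inter> F"
proof -
  have "{f \<in> E. lt f e} = {f \<in> F. lt f e}" if "e \<in> F" for e using assms that by blast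
  then show ?thesis using assms(1) unfolding kruskal_def by auto
qed

lemma kruskal_cong:
  assumes "\<And>e f. e \<in> F \<Longrightarrow> f \<in> F \<Longrightarrow> lt e f \<longleftrightarrow> lt' e f"
  shows "kruskal lt F = kruskal lt' F"
proof -
  have "{f \<in> F. lt f e} = {f \<in> F. lt' f e}" if "e \<in> F" for e using assms that by blast
  then show ?thesis unfolding kruskal_def by auto
qed

lemma strict_order_on_subset: "strict_order_on E lt \<Longrightarrow> F \<subseteq> E \<Longrightarrow> strict_order_on F lt"
  by (auto simp: strict_order_on_def intro: transp_on_subset asymp_on_subset totalp_on_subset)

text \<open>Deletion shrinks the set below each edge, so accepted edges outside \<open>S\<close>
  stay accepted. Gains are controlled by counting: the component count does not drop, so the new
  forest is no larger than the old one and gains no more than it loses.\<close>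

lemma kruskal_delete:
  assumes "finite E" "finite V" "edges_on V E" "strict_order_on E lt" "S \<subseteq> E"
  shows "card (kruskal lt E - kruskal lt (E - S)) \<le> card S"
    and "card (kruskal lt (E - S) - kruskal lt E) \<le> card S"
proof -
  let ?K = "kruskal lt E" and ?L = "kruskal lt (E - S)"
  have fin: "finite ?K" "finite ?L" "finite S" "finite (E - S)"
    using assms finite_subset[OF kruskal_subset] by (auto intro: finite_subset)
  have sub: "?K - S \<subseteq> ?L"
    unfolding kruskal_def using joined_mono[of "{f \<in> E - S. lt f e}" "{f \<in> E. lt f e}" e for e]
    by blast
  then show "card (?K - ?L) \<le> card S" using fin by (intro card_mono) auto
  have "card ?K + comps E V = card V"
    using kruskal_spans[OF assms(1-4)] by simp
  moreover have "card ?L + comps (E - S) V = card V"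
    using kruskal_spans[OF fin(4) assms(2), of lt] strict_order_on_subset[OF assms(4)] assms(3)
    by (auto simp: edges_on_def)
  moreover have "comps E V \<le> comps (E - S) V" by (rule comps_mono) (use assms in auto)
  ultimately have le: "card ?L \<le> card ?K" by simp
  have "card ?L = card (?L \<inter> ?K) + card (?L - ?K)"
    using fin by (metis card_Diff_subset_Int card_mono finite_Int inf_le1 le_add_diff_inverse)
  moreover have "card ?K \<le> card (?L \<inter> ?K) + card S"
  proof -
    have "?K \<subseteq> (?L \<inter> ?K) \<union> S" using sub by auto
    then have "card ?K \<le> card ((?L \<inter> ?K) \<union> S)" using fin by (intro card_mono) auto
    also have "\<dots> \<le> card (?L \<inter> ?K) + card S" by (rule card_Un_le)
    finally show ?thesis .
  qed
  ultimately show "card (?L - ?K) \<le> card S" using le by linarith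
qed

text \<open>On \<open>E - S\<close> the orders agree, so both trees share the reference
  \<open>?L\<close>. The factor 4 is two trees times two one-sided differences, each at most
  \<open>card S\<close>.\<close>

lemma kruskal_stable:
  assumes "finite E" "finite V" "edges_on V E" "strict_order_on E lt" "strict_order_on E lt'" "S \<subseteq> E"
    and "\<And>e f. e \<in> E - S \<Longrightarrow> f \<in> E - S \<Longrightarrow> lt e f \<longleftrightarrow> lt' e f"
  shows "card (sym_diff (kruskal lt E) (kruskal lt' E)) \<le> 4 * card S"
proof -
  let ?K = "kruskal lt E" and ?K' = "kruskal lt' E" and ?L = "kruskal lt (E - S)"
  have K0: "?L = kruskal lt' (E - S)" by (rule kruskal_cong) (use assms in auto)
  note a = kruskal_delete[OF assms(1-4,6)] and b = kruskal_delete[OF assms(1-3,5,6), folded K0]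
  have fin: "finite ?K" "finite ?K'" "finite ?L"
    using assms finite_subset[OF kruskal_subset] by auto
  have "sym_diff ?K ?K' \<subseteq> (?K - ?L) \<union> (?L - ?K) \<union> ((?K' - ?L) \<union> (?L - ?K'))" by auto
  then have "card (sym_diff ?K ?K') \<le> card ((?K - ?L) \<union> (?L - ?K) \<union> ((?K' - ?L) \<union> (?L - ?K')))"
    using fin by (intro card_mono) auto
  also have "\<dots> \<le> (card (?K - ?L) + card (?L - ?K)) + (card (?K' - ?L) + card (?L - ?K'))"
    by (intro order_trans[OF card_Un_le] add_mono card_Un_le)
  finally show ?thesis using a b by linarith
qed

text \<open>Domination of sorted values: the hypotheses say that the i-th smallest value over
  \<open>A\<close> is at most the one over \<open>B\<close>. The induction strips both
  maxima.\<close>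

lemma sum_le_of_threshold_counts:
  fixes f :: "'a \<Rightarrow> real"
  assumes "finite A" "finite B" "card A = card B"
    "\<And>t. card {b \<in> B. f b \<le> t} \<le> card {a \<in> A. f a \<le> t}"
  shows "sum f A \<le> sum f B"
  using assms
proof (induction "card A" arbitrary: A B)
  case 0 then show ?case by simp
next
  case (Suc k)
  have ne: "A \<noteq> {}" "B \<noteq> {}" using Suc.hyps(2) Suc.prems by auto
  have "Max (f ` A) \<in> f ` A" using ne Suc.prems by (intro Max_in) auto
  then obtain a where "a \<in> A" "f a = Max (f ` A)" by force
  then have a: "a \<in> A" "\<And>x. x \<in> A \<Longrightarrow> f x \<le> f a" using Suc.prems by auto
  have "Max (f ` B) \<in> f ` B" using ne Suc.prems by (intro Max_in) auto
  then obtain b where "b \<in> B" "f b = Max (f ` B)" by force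
  then have b: "b \<in> B" "\<And>x. x \<in> B \<Longrightarrow> f x \<le> f b" using Suc.prems by auto
  \<comment> \<open>At threshold \<open>f b\<close> all of \<open>B\<close> is counted, hence all of
    \<open>A\<close>, which compares the two maxima.\<close>
  have "{x \<in> B. f x \<le> f b} = B" using b by auto
  then have "card A \<le> card {x \<in> A. f x \<le> f b}" using Suc.prems(3) Suc.prems(4)[of "f b"] by simp
  then have "{x \<in> A. f x \<le> f b} = A" by (intro card_seteq) (use Suc in auto)
  then have ab: "f a \<le> f b" using a by auto
  have "sum f (A - {a}) \<le> sum f (B - {b})"
  proof (rule Suc.hyps(1))
    show "k = card (A - {a})" "card (A - {a}) = card (B - {b})" using Suc a b by auto
    fix t
    show "card {x \<in> B - {b}. f x \<le> t} \<le> card {x \<in> A - {a}. f x \<le> t}"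
    proof (cases "f a \<le> t")
      case True
      then have "{x \<in> A - {a}. f x \<le> t} = A - {a}" using a by force
      moreover have "card {x \<in> B - {b}. f x \<le> t} \<le> card (B - {b})"
        using Suc by (intro card_mono) auto
      ultimately show ?thesis using Suc a b by simp
    next
      \<comment> \<open>Below \<open>f a\<close> neither removed maximum was counted, since
        \<open>f a \<le> f b\<close>.\<close>
      case False
      then have "{x \<in> A - {a}. f x \<le> t} = {x \<in> A. f x \<le> t}"
        "{x \<in> B - {b}. f x \<le> t} = {x \<in> B. f x \<le> t}" using ab by auto
      then show ?thesis using Suc.prems(4) by simp
    qed
  qed (use Suc in auto)
  then show ?case using ab a b Suc.prems by (simp add: sum.remove)
qed

text \<open>At every threshold the accepted edges form Kruskal's forest of the threshold subgraph
  and attain its rank, while the edges of \<open>T\<close> there form a forest and cannot exceed it.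
  \<open>key\<close> may have ties; it only has to be monotone along \<open>lt\<close>.\<close>

lemma kruskal_minimal:
  fixes key :: "nat set \<Rightarrow> real"
  assumes "finite E" "finite V" "V \<noteq> {}" "edges_on V E" "strict_order_on E lt" "connects E V"
    and key: "\<And>e f. e \<in> E \<Longrightarrow> f \<in> E \<Longrightarrow> lt e f \<Longrightarrow> key e \<le> key f"
    and T: "T \<subseteq> E" "connects T V" "\<nexists>vs. is_cycle T vs"
  shows "sum key (kruskal lt E) \<le> sum key T"
proof (rule sum_le_of_threshold_counts)
  have finT: "finite T" using assms(1) T(1) by (rule rev_finite_subset)
  have on: "edges_on V F" if "F \<subseteq> E" for F using that assms(4) by (auto simp: edges_on_def)
  show "finite (kruskal lt E)" "finite T" using assms finite_subset[OF kruskal_subset] finT by auto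
  have "card T + 1 = card V"
    using acyclic_card[OF finT assms(2) on T(3)] T comps_connects[OF T(2) assms(3)] by simp
  moreover have "card (kruskal lt E) + 1 = card V"
    using kruskal_spans[OF assms(1,2,4,5)] comps_connects[OF assms(6,3)] by simp
  ultimately show "card (kruskal lt E) = card T" by simp
  fix t
  let ?F = "{e \<in> E. key e \<le> t}" and ?T = "{e \<in> T. key e \<le> t}"
  have "kruskal lt ?F = kruskal lt E \<inter> ?F"
    by (rule kruskal_initial) (use key in force)+
  then have *: "{e \<in> kruskal lt E. key e \<le> t} = kruskal lt ?F"
    using kruskal_subset[of lt E] by auto
  have "\<nexists>vs. is_cycle ?T vs" using T(3) unfolding is_cycle_def by blast
  then have "card ?T + comps ?T V = card V"
    using acyclic_card[of ?T V] finT assms(2) on[of ?T] T(1) by auto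
  moreover have "card (kruskal lt ?F) + comps ?F V = card V"
    using kruskal_spans[of ?F V lt] assms(1,2) on[of ?F] strict_order_on_subset[OF assms(5), of ?F] by auto
  moreover have "comps ?F V \<le> comps ?T V"
    by (rule comps_mono) (use assms(2) T in auto)
  ultimately show "card ?T \<le> card {e \<in> kruskal lt E. key e \<le> t}" unfolding * by linarith
qed

section \<open>Spanning trees of a connected graph\<close>

lemma edges_on_graph: "connected_graph G \<Longrightarrow> edges_on (verts G) (edges G)"
  by (auto simp: connected_graph_def wf_graph_def edges_on_def)

lemma finite_edges: "connected_graph G \<Longrightarrow> finite (edges G)"
proof -
  assume "connected_graph G"
  then have "edges G \<subseteq> Pow (verts G)" by (auto simp: connected_graph_def wf_graph_def)
  then show ?thesis by (rule finite_subset) (simp add: verts_def)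
qed

lemma kruskal_spanning_tree:
  assumes "connected_graph G" "strict_order_on (edges G) lt"
  shows "spanning_tree G (kruskal lt (edges G))"
proof -
  let ?V = "verts G" and ?E = "edges G"
  have V: "finite ?V" by (simp add: verts_def)
  note E = finite_edges[OF assms(1)] and on = edges_on_graph[OF assms(1)]
  note ks = kruskal_spans[OF E V on assms(2)]
  have "comps (kruskal lt ?E) ?V = comps ?E ?V" using ks by (simp add: comps_def)
  then have "\<nexists>vs. is_cycle (kruskal lt ?E) vs"
    using ks V on E finite_subset[OF kruskal_subset E] kruskal_subset[of lt ?E]
    by (intro card_acyclic[of _ ?V]) (auto simp: edges_on_def)
  then show ?thesis
    using ks assms(1) kruskal_subset unfolding spanning_tree_def connected_graph_def connects_def
    by simp
qed

lemma spanning_tree_card: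
  assumes "connected_graph G" "spanning_tree G T"
  shows "card T + 1 = nverts G"
proof -
  have "T \<subseteq> edges G" "connects T (verts G)" "\<nexists>vs. is_cycle T vs"
    using assms by (auto simp: spanning_tree_def)
  moreover have "verts G \<noteq> {}" "finite (verts G)" "card (verts G) = nverts G"
    using assms by (auto simp: verts_def connected_graph_def)
  moreover have "edges_on (verts G) T" using edges_on_graph[OF assms(1)] \<open>T \<subseteq> _\<close>
    by (auto simp: edges_on_def)
  ultimately show ?thesis
    using acyclic_card[of T "verts G"] comps_connects[of T "verts G"] finite_edges[OF assms(1)]
    by (simp add: finite_subset)
qed

lemma kruskal_weight_le:
  fixes key :: "nat set \<Rightarrow> real"
  assumes "connected_graph G" "strict_order_on (edges G) lt" "spanning_tree G T"
    and "\<And>e f. e \<in> edges G \<Longrightarrow> f \<in> edges G \<Longrightarrow> lt e f \<Longrightarrow> key e \<le> key f"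
  shows "sum key (kruskal lt (edges G)) \<le> sum key T"
  using assms finite_edges edges_on_graph
  by (intro kruskal_minimal[where V = "verts G"])
    (auto simp: spanning_tree_def connected_graph_def verts_def)

lemma finite_spanning_trees: "connected_graph G \<Longrightarrow> finite {T. spanning_tree G T}"
  by (rule finite_subset[of _ "Pow (edges G)"]) (auto simp: spanning_tree_def finite_edges)

section \<open>Coupling bounds for the earth mover distance\<close>

text \<open>The partial coupling \<open>d\<close> is completed by the product of the residual
  marginals, normalised by the missing mass \<open>1 - m\<close>. Nothing is known about the added
  pairs, so each is charged the maximal distance \<open>D\<close>.\<close>

lemma EM_u_le_subcoupling:
  fixes p q :: "'a set pmf" and d :: "'a set \<Rightarrow> 'a set \<Rightarrow> real" and D :: real
  assumes fin: "finite Z" and p: "set_pmf p \<subseteq> Z" and q: "set_pmf q \<subseteq> Z"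
    and d0: "\<And>S T. 0 \<le> d S T"
    and dp: "\<And>S. S \<in> Z \<Longrightarrow> (\<Sum>T\<in>Z. d S T) \<le> pmf p S"
    and dq: "\<And>T. T \<in> Z \<Longrightarrow> (\<Sum>S\<in>Z. d S T) \<le> pmf q T"
    and D: "\<And>S T. S \<in> Z \<Longrightarrow> T \<in> Z \<Longrightarrow> real (card (sym_diff S T)) \<le> D"
  shows "EM_u p q \<le> ennreal ((\<Sum>S\<in>Z. \<Sum>T\<in>Z. d S T * card (sym_diff S T)) +
    (1 - (\<Sum>S\<in>Z. \<Sum>T\<in>Z. d S T)) * D)"
proof -
  have cart: "sum g (A \<times> B) = (\<Sum>S\<in>A. \<Sum>T\<in>B. g (S, T))" for g :: "'a set \<times> 'a set \<Rightarrow> real" and A B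
    by (simp add: sum.cartesian_product split_def)
  define m where "m = (\<Sum>S\<in>Z. \<Sum>T\<in>Z. d S T)"
  define r where "r S = pmf p S - (\<Sum>T\<in>Z. d S T)" for S
  define c where "c T = pmf q T - (\<Sum>S\<in>Z. d S T)" for T
  define h where "h = (\<lambda>(S, T). if S \<in> Z \<and> T \<in> Z then d S T + r S * c T / (1 - m) else 0)"
  have r0: "0 \<le> r S" if "S \<in> Z" for S using dp that by (simp add: r_def)
  have c0: "0 \<le> c T" if "T \<in> Z" for T using dq that by (simp add: c_def)
  have rs: "sum r Z = 1 - m"
    using sum_pmf_eq_1[OF fin p] by (simp add: r_def m_def sum_subtractf)
  have cs: "sum c Z = 1 - m"
    using sum_pmf_eq_1[OF fin q] unfolding m_def by (subst sum.swap) (simp add: c_def sum_subtractf)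
  have m1: "0 \<le> 1 - m" using rs r0 sum_nonneg[of Z r] by simp
  have h0: "0 \<le> h x" for x using r0 c0 d0 m1 by (auto simp: h_def split: prod.split)
  have row: "(\<Sum>T\<in>Z. h (S, T)) = pmf p S" if S: "S \<in> Z" for S
  proof -
    have "(\<Sum>T\<in>Z. h (S, T)) = (\<Sum>T\<in>Z. d S T) + r S * sum c Z / (1 - m)"
      using S by (simp add: h_def sum.distrib sum_distrib_left sum_divide_distrib)
    moreover have "r S * sum c Z / (1 - m) = r S"
    proof (cases "m = 1")
      \<comment> \<open>Full mass leaves no residual; division by zero yields 0, which is the right
        value here.\<close>
      case True
      then have "r S = 0" using rs r0 S fin by (simp add: sum_nonneg_eq_0_iff)
      then show ?thesis by simp
    qed (simp add: cs)
    ultimately show ?thesis by (simp add: r_def)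
  qed
  have col: "(\<Sum>S\<in>Z. h (S, T)) = pmf q T" if T: "T \<in> Z" for T
  proof -
    have "(\<Sum>S\<in>Z. h (S, T)) = (\<Sum>S\<in>Z. d S T) + sum r Z * c T / (1 - m)"
      using T by (simp add: h_def sum.distrib sum_distrib_right sum_divide_distrib)
    moreover have "sum r Z * c T / (1 - m) = c T"
    proof (cases "m = 1")
      case True
      then have "c T = 0" using cs c0 T fin by (simp add: sum_nonneg_eq_0_iff)
      then show ?thesis by simp
    qed (simp add: rs)
    ultimately show ?thesis by (simp add: c_def)
  qed
  have hsum: "sum h (Z \<times> Z) = 1"
    using sum_pmf_eq_1[OF fin p] row by (simp add: cart)
  have hout: "h x = 0" if "x \<notin> Z \<times> Z" for x using that by (auto simp: h_def split: prod.splits)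
  have "(\<integral>\<^sup>+x. ennreal (h x) \<partial>count_space UNIV) = (\<Sum>x\<in>Z \<times> Z. ennreal (h x))"
    using fin hout by (intro nn_integral_count_space') auto
  also have "\<dots> = 1" using hsum h0 by (simp add: sum_ennreal)
  finally have emb: "(\<integral>\<^sup>+x. ennreal (h x) \<partial>count_space UNIV) = 1" .
  define Q where "Q = embed_pmf h"
  have Q: "pmf Q x = h x" for x unfolding Q_def by (rule pmf_embed_pmf[OF h0 emb])
  have setQ: "set_pmf Q \<subseteq> Z \<times> Z" using hout by (auto simp: set_pmf_eq Q)
  have "map_pmf fst Q = p"
  proof (rule pmf_eqI)
    fix S
    show "pmf (map_pmf fst Q) S = pmf p S"
    proof (cases "S \<in> Z")
      case True
      have "measure Q (fst -` {S}) = measure Q ({S} \<times> Z)"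
        using setQ by (intro measure_pmf.finite_measure_eq_AE) (auto simp: AE_measure_pmf_iff)
      also have "\<dots> = (\<Sum>T\<in>Z. h (S, T))"
        using fin by (simp add: measure_measure_pmf_finite Q cart)
      finally show ?thesis using row True by (simp add: pmf_map)
    next
      case False
      then have "S \<notin> set_pmf p" "S \<notin> set_pmf (map_pmf fst Q)" using p setQ by auto
      then show ?thesis unfolding set_pmf_iff by simp
    qed
  qed
  moreover have "map_pmf snd Q = q"
  proof (rule pmf_eqI)
    fix T
    show "pmf (map_pmf snd Q) T = pmf q T"
    proof (cases "T \<in> Z")
      case True
      have "measure Q (snd -` {T}) = measure Q (Z \<times> {T})"
        using setQ by (intro measure_pmf.finite_measure_eq_AE) (auto simp: AE_measure_pmf_iff)
      also have "\<dots> = (\<Sum>S\<in>Z. h (S, T))"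
        using fin by (simp add: measure_measure_pmf_finite Q cart)
      finally show ?thesis using col True by (simp add: pmf_map)
    next
      case False
      then have "T \<notin> set_pmf q" "T \<notin> set_pmf (map_pmf snd Q)" using q setQ by auto
      then show ?thesis unfolding set_pmf_iff by simp
    qed
  qed
  ultimately have "Q \<in> couplings p q" by (simp add: couplings_def)
  then have "EM_u p q \<le> (\<integral>\<^sup>+ (F, F'). of_nat (card (sym_diff F F')) \<partial>measure_pmf Q)"
    unfolding EM_u_def by (rule INF_lower)
  also have "\<dots> = (\<Sum>x\<in>Z \<times> Z. (case x of (F, F') \<Rightarrow> of_nat (card (sym_diff F F'))) * ennreal (pmf Q x))"
    using fin setQ by (intro nn_integral_measure_pmf_support) auto
  also have "\<dots> = (\<Sum>x\<in>Z \<times> Z. ennreal ((case x of (F, F') \<Rightarrow> real (card (sym_diff F F'))) * h x))"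
    using h0 by (intro sum.cong) (auto simp: Q ennreal_mult ennreal_of_nat_eq_real_of_nat split: prod.split)
  also have "\<dots> = ennreal (\<Sum>x\<in>Z \<times> Z. (case x of (F, F') \<Rightarrow> real (card (sym_diff F F'))) * h x)"
    using h0 by (intro sum_ennreal) (auto split: prod.split)
  also have "\<dots> \<le> ennreal ((\<Sum>S\<in>Z. \<Sum>T\<in>Z. d S T * card (sym_diff S T)) + (1 - m) * D)"
  proof (rule ennreal_leI)
    have "(\<Sum>x\<in>Z \<times> Z. (case x of (F, F') \<Rightarrow> real (card (sym_diff F F'))) * h x) =
        (\<Sum>S\<in>Z. \<Sum>T\<in>Z. real (card (sym_diff S T)) * h (S, T))"
      by (simp add: cart)
    also have "\<dots> \<le> (\<Sum>S\<in>Z. \<Sum>T\<in>Z. d S T * card (sym_diff S T) + r S * c T / (1 - m) * D)"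
    proof (intro sum_mono)
      fix S T assume ST: "S \<in> Z" "T \<in> Z"
      have "real (card (sym_diff S T)) * (r S * c T / (1 - m)) \<le> D * (r S * c T / (1 - m))"
        using D[OF ST] r0[OF ST(1)] c0[OF ST(2)] m1 by (intro mult_right_mono) auto
      then show "real (card (sym_diff S T)) * h (S, T) \<le> d S T * card (sym_diff S T) + r S * c T / (1 - m) * D"
        using ST by (simp add: h_def algebra_simps)
    qed
    also have "\<dots> = (\<Sum>S\<in>Z. \<Sum>T\<in>Z. d S T * card (sym_diff S T)) + (sum r Z * sum c Z / (1 - m)) * D"
      unfolding sum.distrib sum_product unfolding sum_divide_distrib unfolding sum_distrib_right ..
    also have "sum r Z * sum c Z / (1 - m) = 1 - m" by (simp add: rs cs)
    finally show "(\<Sum>x\<in>Z \<times> Z. (case x of (F, F') \<Rightarrow> real (card (sym_diff F F'))) * h x)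
        \<le> (\<Sum>S\<in>Z. \<Sum>T\<in>Z. d S T * card (sym_diff S T)) + (1 - m) * D" .
  qed
  finally show ?thesis by (simp add: m_def)
qed

text \<open>On the overlap both runs use the same \<open>s\<close>, with density
  \<open>1 / lo\<close>. As \<open>lo\<close> is the larger of \<open>a\<close> and
  \<open>b\<close>, this is the smaller of the two densities, so the image mass fits under both
  laws. The sets \<open>B e\<close> collect the widths at which \<open>e\<close> causes a
  difference.\<close>

lemma EM_u_le_overlap:
  fixes p q :: "'a set pmf" and X Y :: "real \<Rightarrow> 'a set" and a b :: real and B :: "'e \<Rightarrow> real set"
  defines "lo \<equiv> max a b" and "hi \<equiv> 2 * min a b"
  assumes ab: "0 < a" "0 < b" "lo \<le> hi"
    and X[measurable]: "X \<in> borel \<rightarrow>\<^sub>M count_space UNIV" and Y[measurable]: "Y \<in> borel \<rightarrow>\<^sub>M count_space UNIV"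
    and Z: "finite Z" "\<And>s. s \<in> {a..2*a} \<Longrightarrow> X s \<in> Z" "\<And>s. s \<in> {b..2*b} \<Longrightarrow> Y s \<in> Z"
    and p: "\<And>T. pmf p T = measure lborel {s \<in> {a..2*a}. X s = T} / a"
    and q: "\<And>T. pmf q T = measure lborel {s \<in> {b..2*b}. Y s = T} / b"
    and D: "\<And>S T. S \<in> Z \<Longrightarrow> T \<in> Z \<Longrightarrow> real (card (sym_diff S T)) \<le> D"
    and B: "finite E" "\<And>e. e \<in> E \<Longrightarrow> B e \<in> sets borel" "\<And>e. e \<in> E \<Longrightarrow> B e \<subseteq> {lo..hi}"
      "\<And>s. s \<in> {lo..hi} \<Longrightarrow> card (sym_diff (X s) (Y s)) \<le> k * card {e \<in> E. s \<in> B e}"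
  shows "EM_u p q \<le> ennreal (k * (\<Sum>e\<in>E. measure lborel (B e)) / lo + (1 - (hi - lo) / lo) * D)"
proof -
  define A where "A S T = {s \<in> {lo..hi}. X s = S \<and> Y s = T}" for S T
  define d where "d S T = measure lborel (A S T) / lo" for S T
  have lo: "0 < lo" "a \<le> lo" "b \<le> lo" "hi \<le> 2 * a" "hi \<le> 2 * b" using ab by (auto simp: lo_def hi_def)
  have fm: "C \<in> fmeasurable lborel" if "C \<in> sets borel" "C \<subseteq> {x..y}" for C and x y :: real
    by (rule fmeasurableI2[of "{x..y}"]) (use that in \<open>auto simp: fmeasurable_def emeasure_lborel_Icc_eq\<close>)
  have A[measurable]: "A S T \<in> sets borel" for S T unfolding A_def by measurable
  have fA: "A S T \<in> fmeasurable lborel" for S T by (rule fm[of _ lo hi]) (auto simp: A_def)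
  have XZ: "X s \<in> Z" "Y s \<in> Z" if "s \<in> {lo..hi}" for s using that Z lo by auto
  have row: "(\<Sum>T\<in>Z. measure lborel (A S T)) = measure lborel {s \<in> {lo..hi}. X s = S}" for S
  proof -
    have "(\<Sum>T\<in>Z. measure lborel (A S T)) = measure lborel (\<Union>T\<in>Z. A S T)"
      using Z(1) fA by (intro measure_UNION'[symmetric]) (auto simp: A_def pairwise_def disjnt_def)
    also have "(\<Union>T\<in>Z. A S T) = {s \<in> {lo..hi}. X s = S}" using XZ by (auto simp: A_def)
    finally show ?thesis .
  qed
  have col: "(\<Sum>S\<in>Z. measure lborel (A S T)) = measure lborel {s \<in> {lo..hi}. Y s = T}" for T
  proof -
    have "(\<Sum>S\<in>Z. measure lborel (A S T)) = measure lborel (\<Union>S\<in>Z. A S T)"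
      using Z(1) fA by (intro measure_UNION'[symmetric]) (auto simp: A_def pairwise_def disjnt_def)
    also have "(\<Union>S\<in>Z. A S T) = {s \<in> {lo..hi}. Y s = T}" using XZ by (auto simp: A_def)
    finally show ?thesis .
  qed
  have "(\<Sum>S\<in>Z. measure lborel {s \<in> {lo..hi}. X s = S}) = measure lborel (\<Union>S\<in>Z. {s \<in> {lo..hi}. X s = S})"
  proof (intro measure_UNION'[symmetric])
    show "{s \<in> {lo..hi}. X s = S} \<in> fmeasurable lborel" for S
      by (rule fm[of _ lo hi]) (auto)
  qed (use Z(1) in \<open>auto simp: pairwise_def disjnt_def\<close>)
  also have "(\<Union>S\<in>Z. {s \<in> {lo..hi}. X s = S}) = {lo..hi}" using XZ by auto
  finally have tot: "(\<Sum>S\<in>Z. measure lborel {s \<in> {lo..hi}. X s = S}) = hi - lo" using ab(3) by simp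
  have mass: "(\<Sum>S\<in>Z. \<Sum>T\<in>Z. d S T) = (hi - lo) / lo"
    unfolding d_def sum_divide_distrib[symmetric] row tot ..
  have setp: "set_pmf p \<subseteq> Z"
  proof
    fix T assume "T \<in> set_pmf p"
    show "T \<in> Z"
    proof (rule ccontr)
      assume "T \<notin> Z"
      then have "{s \<in> {a..2*a}. X s = T} = {}" using Z by blast
      then have "pmf p T = 0" unfolding p by (simp only: measure_empty div_0)
      with \<open>T \<in> set_pmf p\<close> show False by (simp add: set_pmf_iff)
    qed
  qed
  have setq: "set_pmf q \<subseteq> Z"
  proof
    fix T assume "T \<in> set_pmf q"
    show "T \<in> Z"
    proof (rule ccontr)
      assume "T \<notin> Z"
      then have "{s \<in> {b..2*b}. Y s = T} = {}" using Z by blast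
      then have "pmf q T = 0" unfolding q by (simp only: measure_empty div_0)
      with \<open>T \<in> set_pmf q\<close> show False by (simp add: set_pmf_iff)
    qed
  qed
  have dp: "(\<Sum>T\<in>Z. d S T) \<le> pmf p S" for S
  proof -
    have "(\<Sum>T\<in>Z. d S T) = measure lborel {s \<in> {lo..hi}. X s = S} / lo"
      unfolding d_def by (simp add: sum_divide_distrib[symmetric] row)
    also have "\<dots> \<le> measure lborel {s \<in> {a..2*a}. X s = S} / a"
    proof (intro frac_le)
      have "{s \<in> {a..2*a}. X s = S} \<in> fmeasurable lborel" by (rule fm[of _ a "2*a"]) auto
      then show "measure lborel {s \<in> {lo..hi}. X s = S} \<le> measure lborel {s \<in> {a..2*a}. X s = S}"
        using lo by (intro measure_mono_fmeasurable) auto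
    qed (use lo ab in auto)
    finally show ?thesis using p by simp
  qed
  have dq: "(\<Sum>S\<in>Z. d S T) \<le> pmf q T" for T
  proof -
    have "(\<Sum>S\<in>Z. d S T) = measure lborel {s \<in> {lo..hi}. Y s = T} / lo"
      unfolding d_def by (simp add: sum_divide_distrib[symmetric] col)
    also have "\<dots> \<le> measure lborel {s \<in> {b..2*b}. Y s = T} / b"
    proof (intro frac_le)
      have "{s \<in> {b..2*b}. Y s = T} \<in> fmeasurable lborel" by (rule fm[of _ b "2*b"]) auto
      then show "measure lborel {s \<in> {lo..hi}. Y s = T} \<le> measure lborel {s \<in> {b..2*b}. Y s = T}"
        using lo by (intro measure_mono_fmeasurable) auto
    qed (use lo ab in auto)
    finally show ?thesis using q by simp
  qed
  \<comment> \<open>The cost becomes an integral over the width. At each \<open>s\<close> of the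
    overlap only the pair \<open>X s\<close>, \<open>Y s\<close> contributes, so the pointwise bound
    on the distance integrates to the measures of the \<open>B e\<close>.\<close>
  have "(\<Sum>S\<in>Z. \<Sum>T\<in>Z. measure lborel (A S T) * card (sym_diff S T)) =
      (\<integral>s. (\<Sum>S\<in>Z. \<Sum>T\<in>Z. indicator (A S T) s * real (card (sym_diff S T))) \<partial>lborel)"
    using fA by (simp add: fmeasurable_def)
  also have "\<dots> \<le> (\<integral>s. real k * (\<Sum>e\<in>E. indicator (B e) s) \<partial>lborel)"
  proof (rule integral_mono)
    show "integrable lborel (\<lambda>s. \<Sum>S\<in>Z. \<Sum>T\<in>Z. indicator (A S T) s * real (card (sym_diff S T)))"
      using fA by (intro Bochner_Integration.integrable_sum integrable_mult_left) (auto simp: fmeasurable_def)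
    have "B e \<in> fmeasurable lborel" if "e \<in> E" for e using fm[OF B(2,3)] that by blast
    then show "integrable lborel (\<lambda>s. real k * (\<Sum>e\<in>E. indicator (B e) s :: real))"
      by (intro Bochner_Integration.integrable_sum integrable_mult_right) (auto simp: fmeasurable_def)
    fix s :: real
    show "(\<Sum>S\<in>Z. \<Sum>T\<in>Z. indicator (A S T) s * real (card (sym_diff S T))) \<le> real k * (\<Sum>e\<in>E. indicator (B e) s)"
    proof (cases "s \<in> {lo..hi}")
      case True
      have "(\<Sum>S\<in>Z. \<Sum>T\<in>Z. indicator (A S T) s * real (card (sym_diff S T))) =
        (\<Sum>S\<in>Z. \<Sum>T\<in>Z. if S = X s then (if T = Y s then real (card (sym_diff S T)) else 0) else 0)"
        using True by (intro sum.cong refl) (auto simp: A_def indicator_def)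
      also have "\<dots> = (\<Sum>S\<in>Z. if S = X s then (\<Sum>T\<in>Z. if T = Y s then real (card (sym_diff S T)) else 0) else 0)"
        by (intro sum.cong) auto
      also have "\<dots> = real (card (sym_diff (X s) (Y s)))"
        using XZ[OF True] Z(1) by simp
      also have "\<dots> \<le> real (k * card {e \<in> E. s \<in> B e})" using B(4)[OF True] by (simp only: of_nat_le_iff)
      also have "\<dots> = real k * (\<Sum>e\<in>E. indicator (B e) s)"
        using B(1) by (simp add: indicator_def sum.If_cases Int_def)
      finally show ?thesis .
    next
      case False
      then have "(\<Sum>S\<in>Z. \<Sum>T\<in>Z. indicator (A S T) s * real (card (sym_diff S T))) = 0"
        by (intro sum.neutral ballI) (auto simp: A_def)
      then show ?thesis by (simp add: sum_nonneg)
    qed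
  qed
  also have "\<dots> = k * (\<Sum>e\<in>E. measure lborel (B e))"
  proof -
    have "integrable lborel (indicator (B e) :: real \<Rightarrow> real)" if "e \<in> E" for e
      using fm[OF B(2,3)] that by (auto simp: fmeasurable_def)
    then show ?thesis by simp
  qed
  finally have "(\<Sum>S\<in>Z. \<Sum>T\<in>Z. measure lborel (A S T) * card (sym_diff S T)) / lo \<le> k * (\<Sum>e\<in>E. measure lborel (B e)) / lo"
    using lo by (intro divide_right_mono) auto
  then have cost: "(\<Sum>S\<in>Z. \<Sum>T\<in>Z. d S T * card (sym_diff S T)) \<le> k * (\<Sum>e\<in>E. measure lborel (B e)) / lo"
    by (simp add: d_def sum_divide_distrib)
  have "EM_u p q \<le> ennreal ((\<Sum>S\<in>Z. \<Sum>T\<in>Z. d S T * card (sym_diff S T)) + (1 - (hi - lo) / lo) * D)"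
    unfolding mass[symmetric] using lo
    by (intro EM_u_le_subcoupling Z(1) setp setq dp dq D) (auto simp: d_def)
  also have "\<dots> \<le> ennreal (k * (\<Sum>e\<in>E. measure lborel (B e)) / lo + (1 - (hi - lo) / lo) * D)"
    using cost by (intro ennreal_leI add_right_mono)
  finally show ?thesis .
qed

section \<open>From the random tape to finite laws\<close>

lemma pmf_of_finite_range:
  assumes "prob_space M" and X[measurable]: "X \<in> M \<rightarrow>\<^sub>M count_space UNIV"
    and Z: "finite Z" "\<And>x. x \<in> space M \<Longrightarrow> X x \<in> Z"
  shows "\<exists>p. measure_pmf p = distr M (count_space UNIV) X"
proof -
  interpret prob_space M by fact
  let ?D = "distr M (count_space UNIV) X"
  \<comment> \<open>A pmf requires almost every outcome to have positive mass; the finitely many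
    outcomes of mass zero can be excluded together.\<close>
  have "AE x in M. \<forall>z\<in>Z. measure ?D {z} = 0 \<longrightarrow> X x \<noteq> z"
  proof (rule AE_finite_allI[OF Z(1)])
    fix z assume "z \<in> Z"
    show "AE x in M. measure ?D {z} = 0 \<longrightarrow> X x \<noteq> z"
    proof (cases "measure ?D {z} = 0")
      case True
      then have "prob {x \<in> space M. X x = z} = 0"
        by (simp add: measure_distr vimage_def Int_def conj_commute)
      then have "{x \<in> space M. X x = z} \<in> null_sets M"
        by (intro null_setsI) (auto simp: emeasure_eq_measure)
      then show ?thesis by (rule AE_I') auto
    qed simp
  qed
  then have "AE x in M. measure ?D {X x} \<noteq> 0"
    by (rule AE_mp) (use Z(2) in \<open>auto intro!: AE_I2\<close>)
  then have "AE x in ?D. measure ?D {x} \<noteq> 0"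
    by (subst AE_distr_iff) auto
  then have "?D \<in> {M. prob_space M \<and> sets M = UNIV \<and> (AE x in M. measure M {x} \<noteq> 0)}"
    by (simp add: prob_space_distr)
  from Abs_pmf_inverse[OF this] show ?thesis by (rule exI)
qed

lemma prob_space_unit_interval: "prob_space (restrict_space lborel {0..1::real})"
  by (rule prob_spaceI) (simp add: space_restrict_space emeasure_restrict_space)

lemma prob_space_random_tape: "prob_space random_tape"
  unfolding random_tape_def by (intro prob_space_PiM prob_space_unit_interval)

lemma random_tape_component:
  "(\<lambda>\<omega>. \<omega> i) \<in> random_tape \<rightarrow>\<^sub>M restrict_space lborel {0..1}"
  unfolding random_tape_def by simp

lemma random_tape_space: "\<omega> \<in> space random_tape \<Longrightarrow> \<omega> i \<in> {0..1}"
  using measurable_space[OF random_tape_component[of i]] by (simp add: space_restrict_space)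

text \<open>The substitution \<open>s = a * (1 + u)\<close> turns a uniform tape cell into a uniform
  width on \<open>[a, 2a]\<close> and scales Lebesgue measure by \<open>a\<close>.\<close>

lemma random_tape_affine_measure:
  fixes X :: "real \<Rightarrow> 'b"
  assumes X[measurable]: "X \<in> borel \<rightarrow>\<^sub>M count_space UNIV" and a: "0 < a"
  shows "measure random_tape {\<omega> \<in> space random_tape. X (a * (1 + \<omega> i)) = T} =
    measure lborel {s \<in> {a..2 * a}. X s = T} / a"
proof -
  let ?U = "restrict_space lborel {0..1::real}"
  let ?A = "{u \<in> {0..1::real}. X (a * (1 + u)) = T}"
  have A: "?A \<in> sets borel" by measurable
  then have AU: "?A \<in> sets ?U" by (auto simp: sets_restrict_space_iff)
  have d: "distr random_tape ?U (\<lambda>\<omega>. \<omega> i) = ?U"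
    unfolding random_tape_def by (rule distr_PiM_component) (auto intro: prob_space_unit_interval)
  have "measure random_tape {\<omega> \<in> space random_tape. X (a * (1 + \<omega> i)) = T} =
      measure random_tape ((\<lambda>\<omega>. \<omega> i) -` ?A \<inter> space random_tape)"
    using random_tape_space by (intro arg_cong[where f = "measure random_tape"]) auto
  also have "\<dots> = measure (distr random_tape ?U (\<lambda>\<omega>. \<omega> i)) ?A"
    by (rule measure_distr[symmetric, OF random_tape_component AU])
  also have "\<dots> = measure lborel ?A" unfolding d by (rule measure_restrict_space) auto
  finally have 1: "measure random_tape {\<omega> \<in> space random_tape. X (a * (1 + \<omega> i)) = T} = measure lborel ?A" .
  let ?B = "{s \<in> {a..2 * a}. X s = T}"
  have B[measurable]: "?B \<in> sets borel" by measurable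
  have ind: "indicator ?B (a + a * u) = (indicator ?A u :: ennreal)" for u
  proof -
    have "a \<le> a + a * u \<longleftrightarrow> 0 \<le> u" "a + a * u \<le> 2 * a \<longleftrightarrow> a * u \<le> a * 1"
      using a by (auto simp: zero_le_mult_iff)
    moreover have "a * u \<le> a * 1 \<longleftrightarrow> u \<le> 1" using a by (simp only: mult_le_cancel_left_pos)
    ultimately show ?thesis by (auto simp: indicator_def algebra_simps)
  qed
  have "emeasure lborel ?B = (\<integral>\<^sup>+s. indicator ?B s \<partial>lborel)" by (simp)
  also have "\<dots> = \<bar>a\<bar> * (\<integral>\<^sup>+u. indicator ?B (a + a * u) \<partial>lborel)"
    by (rule nn_integral_real_affine) (use a in auto)
  also have "\<dots> = ennreal a * emeasure lborel ?A"
    using a A unfolding ind by simp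
  finally have "measure lborel ?B = a * measure lborel ?A"
    using a by (simp add: measure_def enn2real_mult)
  then show ?thesis using 1 a by simp
qed

section \<open>The tree of the rounded weights\<close>

lemma finite_verts: "finite (verts G)"
  by (simp add: verts_def)

lemma distinct_concat_map:
  assumes "distinct xs" "\<And>x. x \<in> set xs \<Longrightarrow> distinct (f x)"
    "\<And>x y. x \<in> set xs \<Longrightarrow> y \<in> set xs \<Longrightarrow> x \<noteq> y \<Longrightarrow> set (f x) \<inter> set (f y) = {}"
  shows "distinct (concat (map f xs))"
  using assms
proof (induction xs)
  case (Cons x xs)
  have "set (f x) \<inter> set (f y) = {}" if "y \<in> set xs" for y
    using Cons.prems that by auto
  then show ?case using Cons by auto
qed simp

lemma set_edge_list: "set (edge_list G) = {(u, v). u < v \<and> v < nverts G \<and> {u, v} \<in> edges G}"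
  unfolding edge_list_def by auto

lemma distinct_edge_list: "distinct (edge_list G)"
  unfolding edge_list_def by (intro distinct_concat_map) auto

lemma edge_at_bij:
  assumes "connected_graph G"
  shows "bij_betw (edge_at G) {..<length (edge_list G)} (edges G)"
proof (rule bij_betwI')
  fix k l assume "k \<in> {..<length (edge_list G)}" "l \<in> {..<length (edge_list G)}"
  then have kl: "k < length (edge_list G)" "l < length (edge_list G)" by auto
  then have "edge_list G ! k \<in> set (edge_list G)" "edge_list G ! l \<in> set (edge_list G)" by auto
  then show "(edge_at G k = edge_at G l) = (k = l)"
    using nth_eq_iff_index_eq[OF distinct_edge_list kl]
    by (auto simp: edge_at_def set_edge_list doubleton_eq_iff prod_eq_iff)
next
  fix k assume "k \<in> {..<length (edge_list G)}"
  then have "edge_list G ! k \<in> set (edge_list G)" by auto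
  then show "edge_at G k \<in> edges G" by (auto simp: edge_at_def set_edge_list)
next
  fix e assume e: "e \<in> edges G"
  then obtain u v where uv: "u \<in> verts G" "v \<in> verts G" "u \<noteq> v" "e = {u, v}"
    using edges_on_graph[OF assms] by (auto simp: edges_on_def)
  have "(min u v, max u v) \<in> set (edge_list G)"
    using uv e by (auto simp: set_edge_list verts_def min_def max_def insert_commute)
  then obtain k where "k < length (edge_list G)" "edge_list G ! k = (min u v, max u v)"
    by (auto simp: in_set_conv_nth)
  then show "\<exists>k\<in>{..<length (edge_list G)}. e = edge_at G k"
    using uv by (intro bexI[of _ k]) (auto simp: edge_at_def min_def max_def)
qed

lemma length_edge_list: "connected_graph G \<Longrightarrow> length (edge_list G) = card (edges G)"
  using bij_betw_same_card[OF edge_at_bij] by simp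

definition edge_index :: "graph \<Rightarrow> nat set \<Rightarrow> nat" where
  "edge_index G = inv_into {..<length (edge_list G)} (edge_at G)"

lemma edge_index_edge_at:
  "connected_graph G \<Longrightarrow> k < length (edge_list G) \<Longrightarrow> edge_index G (edge_at G k) = k"
  unfolding edge_index_def using bij_betw_imp_inj_on[OF edge_at_bij] by (simp add: inv_into_f_f)

lemma inj_edge_index: "connected_graph G \<Longrightarrow> inj_on (edge_index G) (edges G)"
  unfolding edge_index_def
  using bij_betw_imp_surj_on[OF edge_at_bij] by (metis inj_on_inv_into subset_refl)

text \<open>The tie-break must not depend on the weights: then two keys that agree on a set of edges
  induce the same order there, as \<open>kruskal_stable\<close> demands. The index is the position
  in the machine's input, which a program can compare.\<close>

definition key_order :: "graph \<Rightarrow> (nat set \<Rightarrow> real) \<Rightarrow> nat set \<Rightarrow> nat set \<Rightarrow> bool" where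
  "key_order G key e f \<longleftrightarrow> key e < key f \<or> key e = key f \<and> edge_index G e < edge_index G f"

lemma strict_order_key_order:
  assumes "connected_graph G" shows "strict_order_on (edges G) (key_order G key)"
  unfolding strict_order_on_def
proof (intro conjI)
  show "totalp_on (edges G) (key_order G key)"
  proof (rule totalp_onI)
    fix x y assume "x \<in> edges G" "y \<in> edges G" "x \<noteq> y"
    then have "edge_index G x < edge_index G y \<or> edge_index G y < edge_index G x"
      using inj_edge_index[OF assms] by (metis inj_onD nat_neq_iff)
    then show "key_order G key x y \<or> key_order G key y x"
      by (cases "key x" "key y" rule: linorder_cases) (simp_all add: key_order_def)
  qed
qed (auto simp: key_order_def transp_on_def asymp_on_def)

lemma spanning_tree_kruskal:
  "connected_graph G \<Longrightarrow> spanning_tree G (kruskal (key_order G key) (edges G))"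
  by (intro kruskal_spanning_tree strict_order_key_order)

section \<open>The optimum and its dependence on the weights\<close>

lemma opt_le:
  "connected_graph G \<Longrightarrow> spanning_tree G T \<Longrightarrow> opt G w \<le> weight w T"
  unfolding opt_def using finite_spanning_trees[of G] by (intro Min_le) auto

lemma opt_attained:
  assumes "connected_graph G" obtains T where "spanning_tree G T" "weight w T = opt G w"
proof -
  have "opt G w \<in> weight w ` {T. spanning_tree G T}"
    unfolding opt_def using finite_spanning_trees[OF assms] spanning_tree_kruskal[OF assms]
    by (intro Min_in) auto
  then show ?thesis using that by auto
qed

text \<open>This is how the program gets hold of \<open>opt\<close>: it adds up the weights of the
  greedy tree for the exact weights.\<close>

lemma weight_kruskal_eq_opt:
  assumes "connected_graph G"
  shows "weight w (kruskal (key_order G w) (edges G)) = opt G w"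
proof (rule antisym)
  obtain T where T: "spanning_tree G T" "weight w T = opt G w" by (rule opt_attained[OF assms])
  show "weight w (kruskal (key_order G w) (edges G)) \<le> opt G w"
    unfolding T(2)[symmetric] weight_def
    by (rule kruskal_weight_le[OF assms strict_order_key_order[OF assms] T(1)]) (auto simp: key_order_def)
qed (rule opt_le[OF assms spanning_tree_kruskal[OF assms]])

lemma weights_nonneg: "w \<in> weight_space G \<Longrightarrow> e \<in> edges G \<Longrightarrow> 0 \<le> w e"
  by (auto simp: weight_space_def)

lemma opt_nonneg:
  assumes "connected_graph G" "w \<in> weight_space G" shows "0 \<le> opt G w"
proof -
  obtain T where T: "spanning_tree G T" "weight w T = opt G w" by (rule opt_attained[OF assms(1)])
  then have "0 \<le> weight w T"
    unfolding weight_def using weights_nonneg[OF assms(2)] by (intro sum_nonneg) (auto simp: spanning_tree_def)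
  then show ?thesis using T by simp
qed

text \<open>An optimal tree for \<open>w\<close> is still a candidate for \<open>w'\<close>.\<close>

lemma opt_diff_le:
  assumes "connected_graph G" shows "opt G w' - opt G w \<le> l1_dist G w w'"
proof -
  obtain T where T: "spanning_tree G T" "weight w T = opt G w" by (rule opt_attained[OF assms])
  then have TE: "T \<subseteq> edges G" by (simp add: spanning_tree_def)
  have "opt G w' - opt G w \<le> weight w' T - weight w T" using opt_le[OF assms T(1)] T(2) by simp
  also have "\<dots> = (\<Sum>e\<in>T. w' e - w e)" by (simp add: weight_def sum_subtractf)
  also have "\<dots> \<le> (\<Sum>e\<in>T. \<bar>w e - w' e\<bar>)" by (intro sum_mono) auto
  also have "\<dots> \<le> l1_dist G w w'"
    unfolding l1_dist_def using TE finite_edges[OF assms] by (intro sum_mono2) auto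
  finally show ?thesis .
qed

lemma opt_lipschitz:
  assumes "connected_graph G" shows "\<bar>opt G w - opt G w'\<bar> \<le> l1_dist G w w'"
  using opt_diff_le[OF assms, of w w'] opt_diff_le[OF assms, of w' w]
  by (simp add: l1_dist_def abs_minus_commute)

text \<open>For positive \<open>s\<close> this is ceil(x / s) - 1, truncated to the range from 0 to
  \<open>K\<close>. The sum of indicators needs comparisons only, matching a machine without
  rounding, and is measurable in \<open>s\<close>. Width 0 gives key 0 to weight 0 and key
  \<open>K\<close> to positive weights.\<close>

definition grid_key :: "nat \<Rightarrow> real \<Rightarrow> real \<Rightarrow> real" where
  "grid_key K s x = (\<Sum>k<K. if real (Suc k) * s < x then 1 else 0)"

lemma measurable_grid_key[measurable]: "(\<lambda>s. grid_key K s x) \<in> borel_measurable borel"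
  unfolding grid_key_def by measurable

lemma grid_key_eq:
  assumes "0 \<le> s" "0 \<le> x"
  shows "\<exists>c\<le>K. grid_key K s x = real c \<and> real c * s \<le> x \<and> (c < K \<longrightarrow> x \<le> real (Suc c) * s)"
proof (induction K)
    case 0 then show ?case using assms by (simp add: grid_key_def)
  next
    case (Suc K)
    then obtain c where c: "c \<le> K" "grid_key K s x = real c" "real c * s \<le> x"
      "c < K \<Longrightarrow> x \<le> real (Suc c) * s" by blast
    have S: "grid_key (Suc K) s x = real c + (if real (Suc K) * s < x then 1 else 0)"
      using c(2) by (simp add: grid_key_def)
    show ?case
    proof (cases "real (Suc K) * s < x")
      case True
      \<comment> \<open>Below the cap, \<open>x\<close> would be at most a multiple of
        \<open>s\<close> no larger than the one it exceeds.\<close>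
      have "c = K"
      proof (rule ccontr)
        assume "c \<noteq> K"
        then have "x \<le> real (Suc c) * s" using c by auto
        also have "\<dots> \<le> real (Suc K) * s" using c(1) assms(1) by (intro mult_right_mono) auto
        finally show False using True by simp
      qed
      then show ?thesis using S True by (intro exI[of _ "Suc K"]) auto
    next
      case False
      then have "x \<le> real (Suc c) * s" using c by (cases "c < K") auto
      then show ?thesis using S False c by (intro exI[of _ c]) auto
    qed
  qed

text \<open>
  A crossing needs a multiple \<open>k s\<close> between \<open>x\<close> and \<open>y\<close>. The possible \<open>k\<close> lie in a single
  octave \<open>[j, 2 j]\<close>, and each contributes an interval of widths of length \<open>(y - x) / k\<close>.
\<close>

lemma grid_key_crossing_le:
  assumes "0 < lo" "hi \<le> 2 * lo" "x \<le> y" "y - x \<le> lo"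
  shows "measure lborel {s \<in> {lo..hi}. grid_key K s x \<noteq> grid_key K s y} \<le> 2 * (y - x)"
proof -
  \<comment> \<open>The indices whose grid line can separate \<open>x\<close> from \<open>y\<close>
    for some width in the interval; index \<open>k\<close> stands for the multiple k + 1.\<close>
  define R where "R = {k. k < K \<and> x \<le> real (Suc k) * hi \<and> real (Suc k) * lo < y}"
  have "finite R" by (simp add: R_def)
  have sub: "{s \<in> {lo..hi}. grid_key K s x \<noteq> grid_key K s y} \<subseteq> (\<Union>k\<in>R. {x / Suc k..y / Suc k})"
  proof
    fix s assume "s \<in> {s \<in> {lo..hi}. grid_key K s x \<noteq> grid_key K s y}"
    then have s: "lo \<le> s" "s \<le> hi" "grid_key K s x \<noteq> grid_key K s y" by auto
    have "\<exists>k<K. (real (Suc k) * s < x) \<noteq> (real (Suc k) * s < y)"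
    proof (rule ccontr)
      assume "\<not> ?thesis"
      then have "grid_key K s x = grid_key K s y" unfolding grid_key_def by (intro sum.cong) auto
      then show False using s by simp
    qed
    then obtain k where k: "k < K" "x \<le> real (Suc k) * s" "real (Suc k) * s < y"
      using assms(3) by force
    have "real (Suc k) * s \<le> real (Suc k) * hi" "real (Suc k) * lo \<le> real (Suc k) * s"
      using s by (auto intro!: mult_left_mono simp del: of_nat_Suc)
    then have "k \<in> R" using k unfolding R_def by (intro CollectI conjI) linarith+
    moreover have "s \<in> {x / Suc k..y / Suc k}"
      using k by (simp add: field_simps del: of_nat_Suc)
    ultimately show "s \<in> (\<Union>k\<in>R. {x / Suc k..y / Suc k})" by blast
  qed
  show ?thesis
  proof (cases "R = {}")
    case True
    then have "{s \<in> {lo..hi}. grid_key K s x \<noteq> grid_key K s y} = {}" using sub by blast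
    then have "measure lborel {s \<in> {lo..hi}. grid_key K s x \<noteq> grid_key K s y} = 0"
      by (simp only: measure_empty)
    then show ?thesis using assms(3) by simp
  next
    case False
    define j where "j = Min R"
    have jR: "j \<in> R" "\<And>k. k \<in> R \<Longrightarrow> j \<le> k" using False \<open>finite R\<close> by (auto simp: j_def)
    \<comment> \<open>The smallest index bounds the others: (k + 1) lo < y \<le> x + lo \<le> 2 (j +
      1) lo + lo. This leaves at most j + 2 indices with intervals of length at most (y - x) / (j +
      1), and (j + 2) / (j + 1) \<le> 2.\<close>
    have Rsub: "R \<subseteq> {j..2 * j + 1}"
    proof
      fix k assume k: "k \<in> R"
      have "real (Suc k) * lo < y" using k by (simp add: R_def)
      also have "y \<le> x + lo" using assms by simp
      also have "x \<le> real (Suc j) * hi" using jR by (simp add: R_def)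
      also have "\<dots> \<le> real (Suc j) * (2 * lo)" using assms by (intro mult_left_mono) auto
      finally have "real (Suc k) * lo < real (2 * Suc j + 1) * lo" by (simp add: algebra_simps)
      then have "real (Suc k) < real (2 * Suc j + 1)" using assms(1) by (simp only: mult_less_cancel_right_pos)
      then have "k < 2 * Suc j" by linarith
      then show "k \<in> {j..2 * j + 1}" using jR(2)[OF k] by simp
    qed
    have "measure lborel {s \<in> {lo..hi}. grid_key K s x \<noteq> grid_key K s y} \<le> measure lborel (\<Union>k\<in>R. {x / Suc k..y / Suc k})"
    proof (rule measure_mono_fmeasurable[OF sub])
      show "{s \<in> {lo..hi}. grid_key K s x \<noteq> grid_key K s y} \<in> sets lborel"
        by measurable
      show "(\<Union>k\<in>R. {x / Suc k..y / Suc k}) \<in> fmeasurable lborel"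
        using \<open>finite R\<close> by (intro fmeasurable.finite_UN) (auto simp: fmeasurable_def emeasure_lborel_Icc_eq)
    qed
    also have "\<dots> \<le> (\<Sum>k\<in>R. measure lborel {x / Suc k..y / Suc k})"
      using \<open>finite R\<close> by (intro measure_UNION_le) auto
    also have "\<dots> \<le> (\<Sum>k\<in>R. (y - x) / Suc j)"
    proof (intro sum_mono)
      fix k assume k: "k \<in> R"
      have "measure lborel {x / Suc k..y / Suc k} = (y - x) / Suc k"
        using assms(3) by (simp add: divide_right_mono diff_divide_distrib)
      also have "\<dots> \<le> (y - x) / Suc j" using assms(3) jR(2)[OF k] by (intro divide_left_mono) auto
      finally show "measure lborel {x / Suc k..y / Suc k} \<le> (y - x) / Suc j" .
    qed
    also have "\<dots> = card R * ((y - x) / Suc j)" by simp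
    also have "\<dots> \<le> real (j + 2) * ((y - x) / Suc j)"
      using card_mono[OF _ Rsub] assms(3) by (intro mult_right_mono) auto
    also have "\<dots> = (real (j + 2) / Suc j) * (y - x)" by simp
    also have "\<dots> \<le> 2 * (y - x)" using assms(3) by (intro mult_right_mono) (auto simp: field_simps)
    finally show ?thesis .
  qed
qed

lemma grid_key_crossing:
  assumes "0 < lo" "hi \<le> 2 * lo" "\<bar>x - y\<bar> \<le> lo"
  shows "measure lborel {s \<in> {lo..hi}. grid_key K s x \<noteq> grid_key K s y} \<le> 2 * \<bar>x - y\<bar>"
proof (cases "x \<le> y")
  case True then show ?thesis using grid_key_crossing_le[OF assms(1,2) True, of K] assms(3) by simp
next
  case False
  then show ?thesis using grid_key_crossing_le[OF assms(1,2), of y x K] assms(3) by (simp add: eq_commute)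
qed

definition rounded_tree :: "nat \<Rightarrow> graph \<Rightarrow> weights \<Rightarrow> real \<Rightarrow> nat set set" where
  "rounded_tree K G w s = kruskal (key_order G (\<lambda>e. grid_key K s (w e))) (edges G)"

lemma spanning_tree_rounded_tree: "connected_graph G \<Longrightarrow> spanning_tree G (rounded_tree K G w s)"
  unfolding rounded_tree_def by (rule spanning_tree_kruskal)

text \<open>
  Keys are capped at \<open>K\<close>. The strict inequality on \<open>K\<close> ensures that no edge of the tree has a capped key.
\<close>

lemma weight_rounded_tree:
  fixes s :: real and K :: nat
  assumes G: "connected_graph G" and w: "w \<in> weight_space G"
    and s: "0 \<le> s" "0 < K" "opt G w < K * s \<or> s = 0 \<and> opt G w = 0"
  shows "weight w (rounded_tree K G w s) \<le> opt G w + nverts G * s"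
proof -
  let ?key = "\<lambda>e. grid_key K s (w e)" and ?T = "rounded_tree K G w s"
  obtain T where T: "spanning_tree G T" "weight w T = opt G w" by (rule opt_attained[OF G])
  have TE: "T \<subseteq> edges G" "?T \<subseteq> edges G"
    using T spanning_tree_rounded_tree[OF G] by (auto simp: spanning_tree_def)
  then have fT: "finite T" "finite ?T" using finite_edges[OF G] finite_subset by auto
  have le: "sum ?key ?T \<le> sum ?key T"
    unfolding rounded_tree_def
    by (rule kruskal_weight_le[OF G strict_order_key_order[OF G] T(1)]) (auto simp: key_order_def)
  have key0: "0 \<le> ?key e" for e unfolding grid_key_def by (intro sum_nonneg) auto
  have keyw: "s * ?key e \<le> w e" if "e \<in> edges G" for e
    using grid_key_eq[OF s(1) weights_nonneg[OF w that], of K] by (auto simp: mult.commute)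
  have sle: "s * sum ?key T \<le> opt G w"
    unfolding T(2)[symmetric] weight_def sum_distrib_left using TE keyw by (intro sum_mono) auto
  \<comment> \<open>One key is at most the total key of \<open>?T\<close>, hence at most that of the
    optimal tree \<open>T\<close>, and \<open>s\<close> times the latter is at most
    \<open>opt\<close>.\<close>
  have small: "?key e < K" if e: "e \<in> ?T" for e
  proof -
    have "?key e \<le> sum ?key ?T" using e fT key0 by (intro member_le_sum) auto
    with le have *: "?key e \<le> sum ?key T" by simp
    from s(3) show ?thesis
    proof
      assume "opt G w < K * s"
      then have pos: "0 < s" using opt_nonneg[OF G w] s(1) by (cases "s = 0") auto
      have "s * ?key e \<le> s * sum ?key T" using * s(1) by (intro mult_left_mono)
      then have "s * ?key e < s * K" using sle \<open>opt G w < K * s\<close> by (simp add: mult.commute)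
      then show ?thesis using pos by simp
    next
      \<comment> \<open>At width 0 the optimal tree consists of edges of weight 0, whose keys
        vanish; the total key of \<open>?T\<close> vanishes with them.\<close>
      assume z: "s = 0 \<and> opt G w = 0"
      then have "sum w T = 0" using T by (simp add: weight_def)
      moreover have "0 \<le> w f" if "f \<in> T" for f using weights_nonneg[OF w] TE(1) that by blast
      ultimately have "w f = 0" if "f \<in> T" for f using sum_nonneg_0[OF fT(1)] that by metis
      then have "sum ?key T = 0" using z by (intro sum.neutral) (auto simp: grid_key_def)
      then show ?thesis using * s(2) by simp
    qed
  qed
  have "weight w ?T \<le> (\<Sum>e\<in>?T. s * ?key e + s)"
    unfolding weight_def
  proof (intro sum_mono)
    fix e assume e: "e \<in> ?T"
    then have "0 \<le> w e" using TE weights_nonneg[OF w] by auto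
    from grid_key_eq[OF s(1) this, of K] obtain c where c: "?key e = real c" "c < K \<longrightarrow> w e \<le> real (Suc c) * s"
      by blast
    then have "c < K" using small[OF e] by simp
    then show "w e \<le> s * ?key e + s" using c by (simp add: algebra_simps)
  qed
  also have "\<dots> = s * sum ?key ?T + card ?T * s" by (simp add: sum.distrib sum_distrib_left)
  also have "\<dots> \<le> s * sum ?key T + nverts G * s"
    using spanning_tree_card[OF G spanning_tree_rounded_tree[OF G, of K w s]] le s(1)
    by (intro add_mono mult_left_mono mult_right_mono) auto
  finally show ?thesis using sle by simp
qed

text \<open>The tree depends on \<open>s\<close> only through the comparison relation
  \<open>L s\<close>. This has finitely many possible values, each cut out by finitely many Borel
  comparisons of keys.\<close>

lemma measurable_rounded_tree:
  assumes "connected_graph G"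
  shows "rounded_tree K G w \<in> borel \<rightarrow>\<^sub>M count_space UNIV"
proof -
  let ?E = "edges G"
  define P where "P s x = key_order G (\<lambda>e. grid_key K s (w e)) (fst x) (snd x)" for s x
  define L where "L s = {x \<in> ?E \<times> ?E. P s x}" for s
  define H where "H R = {e \<in> ?E. \<not> joined {f \<in> ?E. (f, e) \<in> R} e}" for R
  have fin: "finite (?E \<times> ?E)" using finite_edges[OF assms] by simp
  have "L \<in> borel \<rightarrow>\<^sub>M count_space (Pow (?E \<times> ?E))"
  proof (subst measurable_count_space_eq2)
    show "finite (Pow (?E \<times> ?E))" using fin by simp
    show "L \<in> space borel \<rightarrow> Pow (?E \<times> ?E) \<and> (\<forall>R\<in>Pow (?E \<times> ?E). L -` {R} \<inter> space borel \<in> sets borel)"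
    proof (intro conjI ballI)
      show "L \<in> space borel \<rightarrow> Pow (?E \<times> ?E)" by (auto simp: L_def)
      fix R assume R: "R \<in> Pow (?E \<times> ?E)"
      have "L s = R \<longleftrightarrow> (\<forall>x\<in>?E \<times> ?E. P s x \<longleftrightarrow> x \<in> R)" for s
        using R unfolding L_def by blast
      then have "L -` {R} \<inter> space borel = space borel \<inter> (\<Inter>x\<in>?E \<times> ?E. {s. P s x \<longleftrightarrow> x \<in> R})"
        by (intro set_eqI) simp
      also have "\<dots> \<in> sets borel"
      proof (cases "?E \<times> ?E = {}")
        case False
        have "{s. P s x \<longleftrightarrow> x \<in> R} \<in> sets borel" for x
        proof -
          have "{s \<in> space borel. grid_key K s (w (fst x)) < grid_key K s (w (snd x))} \<in> sets borel"
            "{s \<in> space borel. grid_key K s (w (fst x)) = grid_key K s (w (snd x))} \<in> sets borel"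
            by measurable
          then have "{s. P s x} \<in> sets borel"
            by (cases "edge_index G (fst x) < edge_index G (snd x)")
              (simp_all add: P_def key_order_def Collect_disj_eq)
          moreover from this have "- {s. P s x} \<in> sets borel" by auto
          ultimately show ?thesis by (cases "x \<in> R") (simp_all add: Collect_neg_eq)
        qed
        then show ?thesis using fin False by (intro sets.Int sets.finite_INT) auto
      qed (simp del: Times_empty)
      finally show "L -` {R} \<inter> space borel \<in> sets borel" .
    qed
  qed
  then have "(\<lambda>s. H (L s)) \<in> borel \<rightarrow>\<^sub>M count_space UNIV"
    by (rule measurable_compose) simp
  also have "(\<lambda>s. H (L s)) = rounded_tree K G w"
    unfolding rounded_tree_def kruskal_def H_def L_def P_def by (intro ext Collect_cong conj_cong refl) simp
  finally show ?thesis .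
qed

lemma rounded_tree_stable:
  assumes "connected_graph G"
  shows "card (sym_diff (rounded_tree K G w s) (rounded_tree K G w' s)) \<le>
    4 * card {e \<in> edges G. grid_key K s (w e) \<noteq> grid_key K s (w' e)}"
  unfolding rounded_tree_def
  by (rule kruskal_stable[where V = "verts G"])
    (use assms in \<open>auto simp: finite_edges edges_on_graph strict_order_key_order finite_verts key_order_def\<close>)

lemma spanning_trees_sym_diff:
  assumes "connected_graph G" "spanning_tree G S" "spanning_tree G T"
  shows "card (sym_diff S T) \<le> 2 * nverts G"
proof -
  have "finite S" "finite T"
    using assms finite_edges[OF assms(1)] by (auto simp: spanning_tree_def intro: finite_subset)
  then have "card (sym_diff S T) \<le> card (S - T) + card (T - S)" "card (S - T) \<le> card S" "card (T - S) \<le> card T"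
    by (auto intro: card_Un_le card_mono)
  then show ?thesis
    using spanning_tree_card[OF assms(1,2)] spanning_tree_card[OF assms(1,3)] by linarith
qed

section \<open>The law of the output tree and its local Lipschitz bound\<close>

lemma tendsto_l1_dist: "((\<lambda>w'. l1_dist G w w') \<longlongrightarrow> 0) (at w within S)"
proof -
  have "((\<lambda>w'. w' e) \<longlongrightarrow> w e) (at w within S)" for e
  proof -
    have "((\<lambda>w' :: weights. w' e) \<longlongrightarrow> w e) (at w within UNIV)"
      using continuous_on_product_coordinates[of e] unfolding continuous_on_def by blast
    then show ?thesis by (rule tendsto_within_subset) simp
  qed
  then have "((\<lambda>w'. \<Sum>e\<in>edges G. \<bar>w e - w' e\<bar>) \<longlongrightarrow> (\<Sum>e\<in>edges G. \<bar>w e - w e\<bar>)) (at w within S)"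
    by (intro tendsto_intros)
  then show ?thesis by (simp add: l1_dist_def)
qed

lemma l1_dist_pos:
  assumes "connected_graph G" "w \<in> weight_space G" "w' \<in> weight_space G" "w \<noteq> w'"
  shows "0 < l1_dist G w w'"
proof -
  obtain e where e: "w e \<noteq> w' e" using assms(4) by auto
  then have "e \<in> edges G" using assms(2,3) unfolding weight_space_def by (metis PiE_arb)
  then have "\<bar>w e - w' e\<bar> \<le> l1_dist G w w'"
    unfolding l1_dist_def using finite_edges[OF assms(1)] by (intro member_le_sum) auto
  then show ?thesis using e by simp
qed

text \<open>A predicate, because the existence of a pmf with this law has to be proved first. With a
  = opt / (N n) the width lies in \<open>[a, 2a]\<close>; the cap is one more than N n, so that opt
  < K s holds already at s = a > 0.\<close>

definition tree_law :: "nat \<Rightarrow> graph \<Rightarrow> weights \<Rightarrow> nat set set pmf \<Rightarrow> bool" where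
  "tree_law N G w p \<longleftrightarrow> measure_pmf p = distr random_tape (count_space UNIV)
     (\<lambda>\<omega>. rounded_tree (N * nverts G + 1) G w (opt G w / (N * nverts G) * (1 + \<omega> 0)))"

lemma measurable_tree_tape:
  assumes "connected_graph G"
  shows "(\<lambda>\<omega>. rounded_tree K G w (a * (1 + \<omega> 0))) \<in> random_tape \<rightarrow>\<^sub>M count_space UNIV"
proof -
  have "(\<lambda>u. a * (1 + u)) \<in> restrict_space lborel {0..1} \<rightarrow>\<^sub>M borel"
    by (rule measurable_restrict_space1) simp
  from measurable_compose[OF measurable_compose[OF random_tape_component this] measurable_rounded_tree[OF assms]]
  show ?thesis .
qed

lemma tree_law_exists:
  assumes "connected_graph G" shows "\<exists>p. tree_law N G w p"
  unfolding tree_law_def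
  by (rule pmf_of_finite_range[OF prob_space_random_tape measurable_tree_tape[OF assms] finite_spanning_trees[OF assms]])
    (simp add: spanning_tree_rounded_tree assms)

lemma tree_law_pmf:
  assumes G: "connected_graph G" and p: "tree_law N G w p" and a: "a = opt G w / (N * nverts G)" "0 < a"
  shows "pmf p T = measure lborel {s \<in> {a..2 * a}. rounded_tree (N * nverts G + 1) G w s = T} / a"
proof -
  have "pmf p T = measure random_tape
      ((\<lambda>\<omega>. rounded_tree (N * nverts G + 1) G w (a * (1 + \<omega> 0))) -` {T} \<inter> space random_tape)"
    using p unfolding pmf.rep_eq tree_law_def a(1)[symmetric]
    by (simp add: measure_distr[OF measurable_tree_tape[OF G]] del: One_nat_def)
  also have "\<dots> = measure random_tape {\<omega> \<in> space random_tape. rounded_tree (N * nverts G + 1) G w (a * (1 + \<omega> 0)) = T}"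
    by (rule arg_cong[where f = "measure random_tape"]) auto
  also have "\<dots> = measure lborel {s \<in> {a..2 * a}. rounded_tree (N * nverts G + 1) G w s = T} / a"
    by (rule random_tape_affine_measure[OF measurable_rounded_tree[OF G] a(2)])
  finally show ?thesis .
qed

text \<open>The part 8 N n / opt is four tree edges times the crossing bound 2, divided by a = opt /
  (N n). The part 4 n / opt is the lost mass 2 \<delta> / opt times the maximal distance 2 n. The
  hypothesis \<open>near\<close> means \<delta> \<le> a / 2: the width intervals overlap, and each
  weight moves by at most \<open>lo\<close>, as the crossing bound requires.\<close>

lemma EM_u_tree_law:
  assumes G: "connected_graph G" and N: "0 < N" and o: "0 < opt G w"
    and p: "tree_law N G w p" and q: "tree_law N G w' q"
    and near: "l1_dist G w w' \<le> opt G w / (2 * N * nverts G)"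
  shows "EM_u p q \<le> ennreal ((8 * N + 4) * nverts G / opt G w * l1_dist G w w')"
proof -
  define n where "n = nverts G"
  define \<delta> where "\<delta> = l1_dist G w w'"
  define K where "K = N * n + 1"
  define a where "a = opt G w / (N * n)"
  define b where "b = opt G w' / (N * n)"
  define lo where "lo = max a b"
  define hi where "hi = 2 * min a b"
  define E where "E = edges G"
  define B where "B e = {s \<in> {lo..hi}. grid_key K s (w e) \<noteq> grid_key K s (w' e)}" for e
  have n: "0 < n" using G by (simp add: n_def connected_graph_def)
  have Nn: "1 \<le> real N * real n" using N n by (metis Suc_leI mult_pos_pos of_nat_1 of_nat_le_iff of_nat_mult One_nat_def)
  have \<delta>a: "\<delta> \<le> a / 2" using near by (simp add: \<delta>_def a_def n_def field_simps)
  have ao: "a * (N * n) = opt G w" using N n by (simp add: a_def)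
  have a0: "0 < a" using o N n by (simp add: a_def)
  have ab: "\<bar>a - b\<bar> * (N * n) \<le> \<delta>"
  proof -
    have "\<bar>a - b\<bar> * (N * n) = \<bar>(a - b) * (N * n)\<bar>" by (simp add: abs_mult)
    also have "(a - b) * (N * n) = opt G w - opt G w'" using N n by (simp add: a_def b_def left_diff_distrib)
    finally show ?thesis using opt_lipschitz[OF G, of w w'] by (simp add: \<delta>_def)
  qed
  have "\<bar>a - b\<bar> * 1 \<le> \<bar>a - b\<bar> * (N * n)" using Nn by (intro mult_left_mono) auto
  then have abd: "\<bar>a - b\<bar> \<le> a / 2" using ab \<delta>a by simp
  then have b0: "0 < b" using a0 by linarith
  have lohi: "lo \<le> hi" "0 < lo" "a \<le> lo" "hi \<le> 2 * lo"
    using abd a0 unfolding lo_def hi_def by linarith+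
  have E: "finite E" using finite_edges[OF G] by (simp add: E_def)
  have \<delta>E: "\<delta> = (\<Sum>e\<in>E. \<bar>w e - w' e\<bar>)" by (simp add: \<delta>_def l1_dist_def E_def)
  have "EM_u p q \<le> ennreal (real 4 * (\<Sum>e\<in>E. measure lborel (B e)) / max a b +
      (1 - (2 * min a b - max a b) / max a b) * real (2 * n))"
  proof (rule EM_u_le_overlap[OF a0 b0])
    show "max a b \<le> 2 * min a b" using lohi by (simp add: lo_def hi_def)
    show "rounded_tree K G w \<in> borel \<rightarrow>\<^sub>M count_space UNIV" "rounded_tree K G w' \<in> borel \<rightarrow>\<^sub>M count_space UNIV"
      by (rule measurable_rounded_tree[OF G])+
    show "finite {T. spanning_tree G T}" by (rule finite_spanning_trees[OF G])
    show "rounded_tree K G w s \<in> {T. spanning_tree G T}" "rounded_tree K G w' s \<in> {T. spanning_tree G T}" for s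
      using spanning_tree_rounded_tree[OF G] by auto
    show "pmf p T = measure lborel {s \<in> {a..2*a}. rounded_tree K G w s = T} / a" for T
      unfolding K_def n_def by (rule tree_law_pmf[OF G p]) (use a0 in \<open>auto simp: a_def n_def\<close>)
    show "pmf q T = measure lborel {s \<in> {b..2*b}. rounded_tree K G w' s = T} / b" for T
      unfolding K_def n_def by (rule tree_law_pmf[OF G q]) (use b0 in \<open>auto simp: b_def n_def\<close>)
    show "real (card (sym_diff S T)) \<le> real (2 * n)"
      if "S \<in> {T. spanning_tree G T}" "T \<in> {T. spanning_tree G T}" for S T
      using spanning_trees_sym_diff[OF G] that by (simp only: of_nat_le_iff n_def mem_Collect_eq)
    show "finite E" by fact
    show "B e \<in> sets borel" for e unfolding B_def by measurable
    show "B e \<subseteq> {max a b..2 * min a b}" for e by (auto simp: B_def lo_def hi_def)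
    show "card (sym_diff (rounded_tree K G w s) (rounded_tree K G w' s)) \<le> 4 * card {e \<in> E. s \<in> B e}"
      if "s \<in> {max a b..2 * min a b}" for s
      using rounded_tree_stable[OF G, of K w s w'] that by (simp add: B_def E_def lo_def hi_def)
  qed
  also have "\<dots> = ennreal (4 * (\<Sum>e\<in>E. measure lborel (B e)) / lo + (1 - (hi - lo) / lo) * (2 * n))"
    by (simp add: lo_def hi_def)
  also have "\<dots> \<le> ennreal ((8 * N + 4) * n / opt G w * \<delta>)"
  proof (rule ennreal_leI)
    have "(\<Sum>e\<in>E. measure lborel (B e)) \<le> (\<Sum>e\<in>E. 2 * \<bar>w e - w' e\<bar>)"
    proof (intro sum_mono)
      fix e assume "e \<in> E"
      then have "\<bar>w e - w' e\<bar> \<le> \<delta>" unfolding \<delta>E using E by (intro member_le_sum) auto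
      then have "\<bar>w e - w' e\<bar> \<le> lo" using \<delta>a lohi a0 by linarith
      then show "measure lborel (B e) \<le> 2 * \<bar>w e - w' e\<bar>"
        unfolding B_def by (rule grid_key_crossing[OF lohi(2,4)])
    qed
    then have "(\<Sum>e\<in>E. measure lborel (B e)) \<le> 2 * \<delta>" by (simp add: \<delta>E sum_distrib_left)
    then have "4 * (\<Sum>e\<in>E. measure lborel (B e)) / lo \<le> 8 * \<delta> / a"
      using lohi a0 by (intro frac_le) (auto simp: sum_nonneg \<delta>E)
    also have "8 * \<delta> / a = 8 * N * n / opt G w * \<delta>" by (simp add: a_def)
    finally have 1: "4 * (\<Sum>e\<in>E. measure lborel (B e)) / lo \<le> 8 * N * n / opt G w * \<delta>" .
    \<comment> \<open>The overlap carries mass 2 min / max - 1, so 2 (max - min) / max is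
      lost.\<close>
    have "1 - (hi - lo) / lo = 2 * \<bar>a - b\<bar> / lo"
      using lohi(2) unfolding lo_def hi_def by (auto simp: field_simps max_def min_def)
    also have "\<dots> \<le> 2 * \<bar>a - b\<bar> / a" using lohi a0 by (intro frac_le) auto
    also have "\<dots> = 2 * (\<bar>a - b\<bar> * (N * n)) / opt G w" using N n by (simp add: ao[symmetric])
    also have "\<dots> \<le> 2 * \<delta> / opt G w" using ab o by (intro divide_right_mono mult_left_mono) auto
    finally have "(1 - (hi - lo) / lo) * (2 * n) \<le> 2 * \<delta> / opt G w * (2 * n)"
      by (intro mult_right_mono) auto
    with 1 show "4 * (\<Sum>e\<in>E. measure lborel (B e)) / lo + (1 - (hi - lo) / lo) * (2 * n)
        \<le> (8 * N + 4) * n / opt G w * \<delta>"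
      by (simp add: algebra_simps add_divide_distrib)
  qed
  finally show ?thesis by (simp add: n_def \<delta>_def)
qed

lemma pointwise_lipschitz_tree_law:
  assumes G: "connected_graph G" and w: "w \<in> weight_space G" and N: "0 < N" and o: "0 < opt G w"
    and A: "\<And>w. w \<in> weight_space G \<Longrightarrow> tree_law N G w (A G w)"
  shows "pointwise_lipschitz_u A G w \<le> ennreal ((8 * N + 4) * nverts G / opt G w)"
  unfolding pointwise_lipschitz_u_def
proof (rule Limsup_bounded)
  have n: "0 < nverts G" using G by (simp add: connected_graph_def)
  have "0 < opt G w / (2 * N * nverts G)" using o N n by simp
  from order_tendstoD(2)[OF tendsto_l1_dist[of G w "weight_space G"] this]
  have "\<forall>\<^sub>F w' in at w within weight_space G. l1_dist G w w' < opt G w / (2 * N * nverts G)" .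
  moreover have "\<forall>\<^sub>F w' in at w within weight_space G. w' \<in> weight_space G \<and> w' \<noteq> w"
    by (simp add: eventually_at_filter)
  ultimately show "\<forall>\<^sub>F w' in at w within weight_space G.
      EM_u (A G w) (A G w') / ennreal (l1_dist G w w') \<le> ennreal ((8 * N + 4) * nverts G / opt G w)"
  proof eventually_elim
    case (elim w')
    let ?c = "(8 * N + 4) * nverts G / opt G w" and ?\<delta> = "l1_dist G w w'"
    \<comment> \<open>Weight vectors agree off the edges, so distinct ones have positive distance
      and the quotient can be cancelled.\<close>
    have d: "0 < ?\<delta>" using l1_dist_pos[OF G w] elim by metis
    have "EM_u (A G w) (A G w') \<le> ennreal (?c * ?\<delta>)"
      using elim by (intro EM_u_tree_law G N o A w) auto
    then have "EM_u (A G w) (A G w') / ennreal ?\<delta> \<le> ennreal (?c * ?\<delta>) / ennreal ?\<delta>"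
      by (rule divide_right_mono_ennreal)
    also have "\<dots> = ennreal ?c" using d o by (subst divide_ennreal) auto
    finally show ?case .
  qed
qed

section \<open>The real RAM program\<close>

text \<open>\<open>final_state\<close> is a definite description; determinism identifies it with any
  state that is reached.\<close>

lemma exec_deterministic:
  assumes "exec \<omega> c s t s'" "exec \<omega> c s t' s''"
  shows "s'' = s'"
  using assms
proof (induction arbitrary: t' s'' rule: exec.induct)
  case Skip then show ?case by (auto elim: exec.cases)
next
  case NAssign then show ?case by (auto elim: exec.cases)
next
  case RAssign then show ?case by (auto elim: exec.cases)
next
  case Sample then show ?case by (auto elim: exec.cases)
next
  case (Seq c s t s1 d t1 s2)
  from Seq.prems obtain u u' r where "exec \<omega> c s u r" "exec \<omega> d r u' s''" by (auto elim: exec.cases)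
  then show ?case using Seq.IH by metis
next
  case (CondTrue b s c t s' d)
  from CondTrue.prems CondTrue.hyps obtain u where "exec \<omega> c s u s''" by (auto elim: exec.cases)
  then show ?case using CondTrue.IH by metis
next
  case (CondFalse b s d t s' c)
  from CondFalse.prems CondFalse.hyps obtain u where "exec \<omega> d s u s''" by (auto elim: exec.cases)
  then show ?case using CondFalse.IH by metis
next
  case (WhileFalse b s c)
  from WhileFalse.prems WhileFalse.hyps show ?case by (auto elim: exec.cases)
next
  case (WhileTrue b s c t s1 t1 s2)
  from WhileTrue.prems WhileTrue.hyps obtain u u' r where "exec \<omega> c s u r" "exec \<omega> (While b c) r u' s''"
    by (auto elim: exec.cases)
  then show ?case using WhileTrue.IH by metis
qed

text \<open>A total correctness triple with a time budget. In \<open>runs_Seq\<close> the triple of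
  the second command is the postcondition of the first, and the budgets add.\<close>

definition runs :: "(nat \<Rightarrow> real) \<Rightarrow> com \<Rightarrow> state \<Rightarrow> nat \<Rightarrow> (state \<Rightarrow> bool) \<Rightarrow> bool" where
  "runs \<omega> c s T Q \<longleftrightarrow> (\<exists>t s'. exec \<omega> c s t s' \<and> t \<le> T \<and> Q s')"

lemma runs_weaken: "runs \<omega> c s T P \<Longrightarrow> (\<And>s'. P s' \<Longrightarrow> Q s') \<Longrightarrow> T \<le> T' \<Longrightarrow> runs \<omega> c s T' Q"
  unfolding runs_def by (meson le_trans)

lemma runs_Skip: "Q s \<Longrightarrow> runs \<omega> Skip s 1 Q"
  unfolding runs_def by (blast intro: exec.Skip)

lemma runs_NAssign:
  "Q (s\<lparr>nats := store (nats s) a (nval i s) (nval x s)\<rparr>) \<Longrightarrow> runs \<omega> (NAssign a i x) s 1 Q"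
  unfolding runs_def by (blast intro: exec.NAssign)

lemma runs_RAssign:
  "Q (s\<lparr>reals := store (reals s) a (nval i s) (rval x s)\<rparr>) \<Longrightarrow> runs \<omega> (RAssign a i x) s 1 Q"
  unfolding runs_def by (blast intro: exec.RAssign)

lemma runs_Sample:
  "Q (s\<lparr>reals := store (reals s) a (nval i s) (\<omega> (used s)), used := Suc (used s)\<rparr>) \<Longrightarrow>
    runs \<omega> (Sample a i) s 1 Q"
  unfolding runs_def by (blast intro: exec.Sample)

lemma runs_Seq: "runs \<omega> c s T (\<lambda>s'. runs \<omega> d s' T' Q) \<Longrightarrow> runs \<omega> (Seq c d) s (T + T') Q"
  unfolding runs_def by (meson add_mono exec.Seq)

lemma runs_Cond:
  assumes "bval b s \<Longrightarrow> runs \<omega> c s T Q" "\<not> bval b s \<Longrightarrow> runs \<omega> d s T Q"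
  shows "runs \<omega> (Cond b c d) s (Suc T) Q"
  using assms unfolding runs_def by (cases "bval b s") (meson Suc_le_mono exec.CondTrue exec.CondFalse)+

definition For :: "nat \<Rightarrow> nexp \<Rightarrow> com \<Rightarrow> com" where
  "For a b c = Seq (NAssign a (NLit 0) (NLit 0))
     (While (NLess (NArr a (NLit 0)) b) (Seq c (NAssign a (NLit 0) (NPlus (NArr a (NLit 0)) (NLit 1)))))"

text \<open>The bound is evaluated anew at each test, so the invariant must keep its value. A round
  costs the body, one test and one increment; the final 2 pays for the initialisation and the
  failing test.\<close>

lemma runs_For:
  assumes init: "I 0 (s\<lparr>nats := store (nats s) a 0 0\<rparr>)"
    and bound: "\<And>k s. k \<le> n \<Longrightarrow> I k s \<Longrightarrow> nats s a 0 = k \<Longrightarrow> nval b s = n"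
    and step: "\<And>k s. k < n \<Longrightarrow> I k s \<Longrightarrow> nats s a 0 = k \<Longrightarrow>
      runs \<omega> c s T (\<lambda>s'. nats s' a 0 = k \<and> I (Suc k) (s'\<lparr>nats := store (nats s') a 0 (Suc k)\<rparr>))"
    and post: "\<And>s. I n s \<Longrightarrow> Q s"
  shows "runs \<omega> (For a b c) s (n * (T + 2) + 2) Q"
proof -
  let ?w = "While (NLess (NArr a (NLit 0)) b) (Seq c (NAssign a (NLit 0) (NPlus (NArr a (NLit 0)) (NLit 1))))"
  have loop: "runs \<omega> ?w s ((n - k) * (T + 2) + 1) Q" if "k \<le> n" "I k s" "nats s a 0 = k" for k s
    using that
  proof (induction "n - k" arbitrary: k s)
    case 0
    then have "k = n" by simp
    then have "\<not> bval (NLess (NArr a (NLit 0)) b) s" "Q s" using bound[of k s] post 0 by auto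
    then show ?case unfolding runs_def using exec.WhileFalse by fastforce
  next
    case (Suc j)
    then have k: "k < n" by simp
    then have b: "bval (NLess (NArr a (NLit 0)) b) s" using bound[of k s] Suc by simp
    obtain t s' where s': "exec \<omega> c s t s'" "t \<le> T" "nats s' a 0 = k"
      "I (Suc k) (s'\<lparr>nats := store (nats s') a 0 (Suc k)\<rparr>)"
      using step[OF k Suc.prems(2,3)] unfolding runs_def by blast
    let ?s = "s'\<lparr>nats := store (nats s') a 0 (Suc k)\<rparr>"
    have "exec \<omega> (NAssign a (NLit 0) (NPlus (NArr a (NLit 0)) (NLit 1))) s' 1 ?s"
      using exec.NAssign[of \<omega> a "NLit 0" "NPlus (NArr a (NLit 0)) (NLit 1)" s'] s'(3) by simp
    from exec.Seq[OF s'(1) this]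
    have 1: "exec \<omega> (Seq c (NAssign a (NLit 0) (NPlus (NArr a (NLit 0)) (NLit 1)))) s (t + 1) ?s" .
    have "runs \<omega> ?w ?s ((n - Suc k) * (T + 2) + 1) Q"
      using Suc.hyps(2) k s' by (intro Suc.hyps(1)) (auto simp: store_def)
    then obtain t' s'' where 2: "exec \<omega> ?w ?s t' s''" "t' \<le> (n - Suc k) * (T + 2) + 1" "Q s''"
      unfolding runs_def by blast
    have "Suc (t + 1 + t') \<le> (n - k) * (T + 2) + 1"
    proof -
      have "n - k = Suc (n - Suc k)" using k by simp
      then have "(n - k) * (T + 2) = (T + 2) + (n - Suc k) * (T + 2)" by simp
      then show ?thesis using 2(2) s'(2) by linarith
    qed
    then show ?case unfolding runs_def using exec.WhileTrue[OF b 1 2(1)] 2(3) by blast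
  qed
  have "runs \<omega> (For a b c) s (1 + ((n - 0) * (T + 2) + 1)) Q"
    unfolding For_def by (intro runs_Seq runs_NAssign loop) (use init in \<open>auto simp: store_def\<close>)
  then show ?thesis by simp
qed

lemma store_other: "b \<noteq> a \<Longrightarrow> store m a i x b = m b"
  by (simp add: store_def)

text \<open>The counter \<open>used\<close> is included because the sample drawn after the first
  greedy pass must still read cell 0 of the tape.\<close>

definition frame :: "nat set \<Rightarrow> nat set \<Rightarrow> state \<Rightarrow> state \<Rightarrow> bool" where
  "frame A R s s' \<longleftrightarrow> (\<forall>a. a \<notin> A \<longrightarrow> nats s' a = nats s a) \<and>
     (\<forall>a. a \<notin> R \<longrightarrow> reals s' a = reals s a) \<and> used s' = used s"

lemma frame_refl: "frame A R s s"
  by (simp add: frame_def)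

lemma frame_trans: "frame A R s s' \<Longrightarrow> frame A' R' s' s'' \<Longrightarrow> A' \<subseteq> A \<Longrightarrow> R' \<subseteq> R \<Longrightarrow> frame A R s s''"
  unfolding frame_def by (metis subsetD)

lemma frame_nats: "frame A R s s' \<Longrightarrow> a \<notin> A \<Longrightarrow> nats s' a = nats s a"
  by (simp add: frame_def)

lemma frame_reals: "frame A R s s' \<Longrightarrow> a \<notin> R \<Longrightarrow> reals s' a = reals s a"
  by (simp add: frame_def)

lemma frame_store_nats: "frame A R s s' \<Longrightarrow> a \<in> A \<Longrightarrow> frame A R s (s'\<lparr>nats := store (nats s') a i x\<rparr>)"
  by (auto simp: frame_def store_def)

definition holds_input :: "nat \<Rightarrow> nat \<Rightarrow> (nat \<Rightarrow> nat) \<Rightarrow> (nat \<Rightarrow> nat) \<Rightarrow> (nat \<Rightarrow> real) \<Rightarrow> state \<Rightarrow> bool" where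
  "holds_input n m U V W s \<longleftrightarrow> nats s 0 0 = n \<and> nats s 0 1 = m \<and>
     (\<forall>k<m. nats s 1 k = U k \<and> nats s 2 k = V k \<and> reals s 0 k = W k \<and> U k < n \<and> V k < n)"

lemma holds_input_frame:
  "holds_input n m U V W s \<Longrightarrow> frame A R s s' \<Longrightarrow> {0, 1, 2} \<inter> A = {} \<Longrightarrow> 0 \<notin> R \<Longrightarrow> holds_input n m U V W s'"
  unfolding holds_input_def frame_def by auto

lemma labels_cong:
  "labels f F V \<Longrightarrow> (\<And>x. x \<in> V \<Longrightarrow> g x = f x) \<Longrightarrow> labels g F V"
  by (simp add: labels_def)

text \<open>
  Memory layout: array 3 holds the selected edges, array 4 the component labels, arrays 5 to 9
  scratch scalars. Of the real arrays, 1 holds the keys, 2 the accumulated weight and 3 the grid width.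
\<close>

abbreviation "n_verts \<equiv> NArr 0 (NLit 0)"
abbreviation "n_edges \<equiv> NArr 0 (NLit 1)"
abbreviation "var a \<equiv> NArr a (NLit 0)"

definition NEq :: "nexp \<Rightarrow> nexp \<Rightarrow> bexp" where
  "NEq x y = BAnd (BNot (NLess x y)) (BNot (NLess y x))"

lemma bval_NEq: "bval (NEq x y) s \<longleftrightarrow> nval x s = nval y s"
  by (auto simp: NEq_def)

section \<open>Greedy selection by component labels\<close>

definition reset_labels :: com where
  "reset_labels = For 7 n_verts (NAssign 4 (var 7) (var 7))"

lemma runs_reset_labels:
  assumes "holds_input n m U V W s"
  shows "runs \<omega> reset_labels s (3 * n + 2)
    (\<lambda>s'. frame {4, 7} {} s s' \<and> labels (nats s' 4) {} {..<n})"
proof -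
  have "runs \<omega> (For 7 n_verts (NAssign 4 (var 7) (var 7))) s (n * (1 + 2) + 2)
    (\<lambda>s'. frame {4, 7} {} s s' \<and> labels (nats s' 4) {} {..<n})"
  proof (rule runs_For[where I = "\<lambda>k s'. frame {4, 7} {} s s' \<and> (\<forall>x<k. nats s' 4 x = x)"])
    show "frame {4, 7} {} s s' \<and> labels (nats s' 4) {} {..<n}"
      if "frame {4, 7} {} s s' \<and> (\<forall>x<n. nats s' 4 x = x)" for s'
      using that by (auto simp: labels_def adj_def)
  next
    fix k s' assume "frame {4, 7} {} s s' \<and> (\<forall>x<k. nats s' 4 x = x)"
    then show "nval n_verts s' = n" using assms by (auto simp: frame_nats holds_input_def)
  next
    fix k s' assume "frame {4, 7} {} s s' \<and> (\<forall>x<k. nats s' 4 x = x)" "nats s' 7 0 = k"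
    then show "runs \<omega> (NAssign 4 (var 7) (var 7)) s' 1 (\<lambda>s'. nats s' 7 0 = k \<and>
       frame {4, 7} {} s (s'\<lparr>nats := store (nats s') 7 0 (Suc k)\<rparr>) \<and>
       (\<forall>x<Suc k. nats (s'\<lparr>nats := store (nats s') 7 0 (Suc k)\<rparr>) 4 x = x))"
      by (intro runs_NAssign) (auto intro!: frame_store_nats simp: store_def less_Suc_eq frame_def)
  qed (auto intro: frame_store_nats frame_refl)
  then show ?thesis unfolding reset_labels_def by (rule runs_weaken) auto
qed

text \<open>Both labels are copied to scratch cells first, since the loop overwrites the array that
  holds them.\<close>

definition merge_labels :: com where
  "merge_labels = Seq (NAssign 8 (NLit 0) (NArr 4 (NArr 1 (var 6))))
     (Seq (NAssign 9 (NLit 0) (NArr 4 (NArr 2 (var 6))))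
       (For 7 n_verts (Cond (NEq (NArr 4 (var 7)) (var 9)) (NAssign 4 (var 7) (var 8)) Skip)))"

lemma runs_merge_labels:
  assumes inp: "holds_input n m U V W s" and j: "nats s 6 0 = j" "j < m"
    and lab: "labels (nats s 4) F {..<n}"
  shows "runs \<omega> merge_labels s (4 * n + 4)
    (\<lambda>s'. frame {4, 7, 8, 9} {} s s' \<and> labels (nats s' 4) (insert {U j, V j} F) {..<n})"
proof -
  define f where "f = nats s 4"
  define s1 where "s1 = s\<lparr>nats := store (store (nats s) 8 0 (f (U j))) 9 0 (f (V j))\<rparr>"
  have UV: "U j < n" "V j < n" "nats s 1 j = U j" "nats s 2 j = V j" "nats s 0 0 = n"
    using inp j by (auto simp: holds_input_def)
  let ?I = "\<lambda>k s'. frame {4, 7} {} s1 s' \<and> (\<forall>x<n. nats s' 4 x = (if x < k \<and> f x = f (V j) then f (U j) else f x))"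
  have s1: "nats s1 8 0 = f (U j)" "nats s1 9 0 = f (V j)" "nats s1 4 = f" "nats s1 0 0 = n"
    using UV by (auto simp: s1_def store_def f_def)
  have fr: "frame {4, 7, 8, 9} {} s s1" by (auto simp: s1_def frame_def store_def)
  have "runs \<omega> (For 7 n_verts (Cond (NEq (NArr 4 (var 7)) (var 9)) (NAssign 4 (var 7) (var 8)) Skip)) s1
      (n * (Suc 1 + 2) + 2) (\<lambda>s'. frame {4, 7, 8, 9} {} s s' \<and> labels (nats s' 4) (insert {U j, V j} F) {..<n})"
  proof (rule runs_For[where I = ?I])
    show "?I 0 (s1\<lparr>nats := store (nats s1) 7 0 0\<rparr>)"
      using s1 by (auto simp: store_def frame_def)
  next
    fix k s' assume "?I k s'"
    then show "nval n_verts s' = n" using s1 by (auto simp: frame_nats)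
  next
    fix k s' assume k: "k < n" "?I k s'" "nats s' 7 0 = k"
    then have v: "nats s' 8 0 = f (U j)" "nats s' 9 0 = f (V j)" "nats s' 4 k = f k"
      using s1 by (auto simp: frame_nats)
    show "runs \<omega> (Cond (NEq (NArr 4 (var 7)) (var 9)) (NAssign 4 (var 7) (var 8)) Skip) s' (Suc 1)
      (\<lambda>s'. nats s' 7 0 = k \<and> ?I (Suc k) (s'\<lparr>nats := store (nats s') 7 0 (Suc k)\<rparr>))"
      using k v
      by (intro runs_Cond runs_NAssign runs_Skip)
        (auto intro!: frame_store_nats simp: store_def less_Suc_eq frame_def bval_NEq)
  next
    fix s' assume I: "?I n s'"
    have "labels (\<lambda>x. if f x = f (V j) then f (U j) else f x) (insert {U j, V j} F) {..<n}"
      by (rule labels_insert) (use lab UV in \<open>auto simp: f_def\<close>)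
    then have "labels (nats s' 4) (insert {U j, V j} F) {..<n}"
      by (rule labels_cong) (use I in auto)
    then show "frame {4, 7, 8, 9} {} s s' \<and> labels (nats s' 4) (insert {U j, V j} F) {..<n}"
      using I frame_trans[OF fr] by blast
  qed
  then have "runs \<omega> merge_labels s (1 + (1 + (n * (Suc 1 + 2) + 2)))
    (\<lambda>s'. frame {4, 7, 8, 9} {} s s' \<and> labels (nats s' 4) (insert {U j, V j} F) {..<n})"
    unfolding merge_labels_def
    by (intro runs_Seq runs_NAssign) (use UV j in \<open>simp add: s1_def f_def store_def\<close>)
  then show ?thesis by (rule runs_weaken) auto
qed

definition before :: "(nat \<Rightarrow> real) \<Rightarrow> nat \<Rightarrow> nat \<Rightarrow> bool" where
  "before \<kappa> j i \<longleftrightarrow> \<kappa> j < \<kappa> i \<or> \<kappa> j = \<kappa> i \<and> j < i"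

text \<open>Disjunction is a negated conjunction. In place of equal keys the second case only denies
  the reverse inequality, which amounts to the same once the first case fails.\<close>

definition before_exp :: bexp where
  "before_exp = BNot (BAnd (BNot (RLess (RArr 1 (var 6)) (RArr 1 (var 5))))
     (BNot (BAnd (BNot (RLess (RArr 1 (var 5)) (RArr 1 (var 6)))) (NLess (var 6) (var 5)))))"

lemma bval_before: "bval before_exp s \<longleftrightarrow> before (reals s 1) (nats s 6 0) (nats s 5 0)"
  by (auto simp: before_exp_def before_def)

text \<open>All smaller edges are joined, accepted or not, as in \<open>kruskal\<close>. Components
  are rebuilt for each edge, so the edges never have to be sorted.\<close>

definition join_before :: com where
  "join_before = For 6 n_edges (Cond before_exp merge_labels Skip)"

lemma runs_join_before:
  assumes inp: "holds_input n m U V W s" and i: "nats s 5 0 = i"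
    and lab: "labels (nats s 4) {} {..<n}"
  shows "runs \<omega> join_before s (m * (4 * n + 7) + 2)
    (\<lambda>s'. frame {4, 6, 7, 8, 9} {} s s' \<and>
      labels (nats s' 4) ((\<lambda>j. {U j, V j}) ` {j. j < m \<and> before (reals s 1) j i}) {..<n})"
proof -
  let ?F = "\<lambda>k. (\<lambda>j. {U j, V j}) ` {j. j < k \<and> before (reals s 1) j i}"
  let ?I = "\<lambda>k s'. frame {4, 6, 7, 8, 9} {} s s' \<and> labels (nats s' 4) (?F k) {..<n}"
  have "runs \<omega> (For 6 n_edges (Cond before_exp merge_labels Skip)) s (m * (Suc (4 * n + 4) + 2) + 2) (?I m)"
  proof (rule runs_For[where I = ?I])
    show "?I 0 (s\<lparr>nats := store (nats s) 6 0 0\<rparr>)"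
      using lab by (auto simp: store_def frame_def)
  next
    fix k s' assume "?I k s'"
    then show "nval n_edges s' = m" using inp by (auto simp: frame_nats holds_input_def)
  next
    fix k s' assume k: "k < m" "?I k s'" "nats s' 6 0 = k"
    have inp': "holds_input n m U V W s'" by (rule holds_input_frame[OF inp conjunct1[OF k(2)]]) auto
    have b: "bval before_exp s' \<longleftrightarrow> before (reals s 1) k i"
      using k i by (auto simp: bval_before frame_nats frame_reals)
    let ?Q = "\<lambda>s'. nats s' 6 0 = k \<and> ?I (Suc k) (s'\<lparr>nats := store (nats s') 6 0 (Suc k)\<rparr>)"
    show "runs \<omega> (Cond before_exp merge_labels Skip) s' (Suc (4 * n + 4)) ?Q"
    proof (rule runs_Cond)
      assume "bval before_exp s'"
      then have F: "?F (Suc k) = insert {U k, V k} (?F k)" using b by (auto simp: less_Suc_eq)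
      show "runs \<omega> merge_labels s' (4 * n + 4) ?Q"
      proof (rule runs_weaken[OF runs_merge_labels[OF inp' k(3,1) conjunct2[OF k(2)]] _ order_refl])
        fix s'' assume s'': "frame {4, 7, 8, 9} {} s' s'' \<and> labels (nats s'' 4) (insert {U k, V k} (?F k)) {..<n}"
        then have "frame {4, 6, 7, 8, 9} {} s s''" using k(2) by (auto intro: frame_trans)
        then show "?Q s''" using s'' k(3) unfolding F
          by (auto intro: frame_store_nats simp: frame_nats store_other)
      qed
    next
      assume "\<not> bval before_exp s'"
      then have F: "?F (Suc k) = ?F k" using b by (auto simp: less_Suc_eq)
      have "runs \<omega> Skip s' 1 ?Q"
        using k unfolding F by (intro runs_Skip) (auto intro: frame_store_nats simp: store_other)
      then show "runs \<omega> Skip s' (4 * n + 4) ?Q" by (rule runs_weaken) auto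
    qed
  qed
  then show ?thesis unfolding join_before_def by (rule runs_weaken) auto
qed

text \<open>Rejection must store 0 explicitly, because the second pass reuses the array filled by
  the first. The accumulated weight is the original one and not the key.\<close>

definition select :: com where
  "select = Cond (NEq (NArr 4 (NArr 1 (var 5))) (NArr 4 (NArr 2 (var 5))))
     (NAssign 3 (var 5) (NLit 0))
     (Seq (NAssign 3 (var 5) (NLit 1)) (RAssign 2 (NLit 0) (RPlus (RArr 2 (NLit 0)) (RArr 0 (var 5)))))"

definition greedy :: com where
  "greedy = Seq (RAssign 2 (NLit 0) (RLit 0))
     (For 5 n_edges (Seq reset_labels (Seq join_before select)))"

definition selected :: "nat \<Rightarrow> (nat \<Rightarrow> nat) \<Rightarrow> (nat \<Rightarrow> nat) \<Rightarrow> (nat \<Rightarrow> real) \<Rightarrow> nat \<Rightarrow> bool" where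
  "selected m U V \<kappa> i \<longleftrightarrow> \<not> joined ((\<lambda>j. {U j, V j}) ` {j. j < m \<and> before \<kappa> j i}) {U i, V i}"

definition greedy_time :: "nat \<Rightarrow> nat \<Rightarrow> nat" where
  "greedy_time n m = 1 + (m * (((3 * n + 2) + ((m * (4 * n + 7) + 2) + 3)) + 2) + 2)"

lemma runs_greedy:
  assumes inp: "holds_input n m U V W s"
  shows "runs \<omega> greedy s (greedy_time n m)
    (\<lambda>s'. frame {3, 4, 5, 6, 7, 8, 9} {2} s s' \<and>
      (\<forall>i<m. nats s' 3 i = of_bool (selected m U V (reals s 1) i)) \<and>
      reals s' 2 0 = (\<Sum>i | i < m \<and> selected m U V (reals s 1) i. W i))"
proof -
  let ?sel = "selected m U V (reals s 1)"
  let ?I = "\<lambda>k s'. frame {3, 4, 5, 6, 7, 8, 9} {2} s s' \<and> (\<forall>i<k. nats s' 3 i = of_bool (?sel i)) \<and>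
    reals s' 2 0 = (\<Sum>i | i < k \<and> ?sel i. W i)"
  let ?s = "s\<lparr>reals := store (reals s) 2 0 0\<rparr>"
  have "runs \<omega> (For 5 n_edges (Seq reset_labels (Seq join_before select))) ?s
      (m * (((3 * n + 2) + ((m * (4 * n + 7) + 2) + 3)) + 2) + 2) (?I m)"
  proof (rule runs_For[where I = ?I])
    show "?I 0 (?s\<lparr>nats := store (nats ?s) 5 0 0\<rparr>)"
      by (auto simp: store_def frame_def)
  next
    fix k s' assume "?I k s'"
    then show "nval n_edges s' = m" using inp by (auto simp: frame_nats holds_input_def)
  next
    fix k s' assume k: "k < m" "?I k s'" "nats s' 5 0 = k"
    have inp': "holds_input n m U V W s'" by (rule holds_input_frame[OF inp conjunct1[OF k(2)]]) auto
    let ?Q = "\<lambda>s'. nats s' 5 0 = k \<and> ?I (Suc k) (s'\<lparr>nats := store (nats s') 5 0 (Suc k)\<rparr>)"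
    show "runs \<omega> (Seq reset_labels (Seq join_before select)) s' ((3 * n + 2) + ((m * (4 * n + 7) + 2) + 3)) ?Q"
    proof (rule runs_Seq, rule runs_weaken[OF runs_reset_labels[OF inp'] _ order_refl], rule runs_Seq)
      fix s1 assume s1: "frame {4, 7} {} s' s1 \<and> labels (nats s1 4) {} {..<n}"
      have inp1: "holds_input n m U V W s1" by (rule holds_input_frame[OF inp' conjunct1[OF s1]]) auto
      have k1: "nats s1 5 0 = k" "reals s1 1 = reals s 1" using s1 k by (auto simp: frame_nats frame_reals)
      let ?F = "(\<lambda>j. {U j, V j}) ` {j. j < m \<and> before (reals s 1) j k}"
      show "runs \<omega> join_before s1 (m * (4 * n + 7) + 2) (\<lambda>s'. runs \<omega> select s' 3 ?Q)"
      proof (rule runs_weaken[OF runs_join_before[OF inp1 k1(1) conjunct2[OF s1]] _ order_refl])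
        fix s2 assume s2: "frame {4, 6, 7, 8, 9} {} s1 s2 \<and>
          labels (nats s2 4) ((\<lambda>j. {U j, V j}) ` {j. j < m \<and> before (reals s1 1) j k}) {..<n}"
        have inp2: "holds_input n m U V W s2" by (rule holds_input_frame[OF inp1 conjunct1[OF s2]]) auto
        have UV: "nats s2 1 k = U k" "nats s2 2 k = V k" "U k < n" "V k < n" "reals s2 0 k = W k"
          using inp2 k(1) by (auto simp: holds_input_def)
        have k2: "nats s2 5 0 = k" using s2 k1 by (auto simp: frame_nats)
        have fr: "frame {3, 4, 5, 6, 7, 8, 9} {2} s s2"
          using k(2) s1 s2 by (auto intro: frame_trans)
        have eq: "nats s2 4 (U k) = nats s2 4 (V k) \<longleftrightarrow> \<not> ?sel k"
          using s2[unfolded k1(2)] UV by (simp add: selected_def labels_def joined_doubleton)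
        have old: "\<forall>i<k. nats s2 3 i = of_bool (?sel i)" "reals s2 2 0 = (\<Sum>i | i < k \<and> ?sel i. W i)"
          using s1 s2 k(2) by (auto simp: frame_nats frame_reals)
        have sumS: "(\<Sum>i | i < Suc k \<and> ?sel i. W i) = (\<Sum>i | i < k \<and> ?sel i. W i) + (if ?sel k then W k else 0)"
        proof (cases "?sel k")
          case True
          then have "{i. i < Suc k \<and> ?sel i} = insert k {i. i < k \<and> ?sel i}" by (auto simp: less_Suc_eq)
          then show ?thesis using True by simp
        next
          case False
          then have "{i. i < Suc k \<and> ?sel i} = {i. i < k \<and> ?sel i}" by (auto simp: less_Suc_eq)
          then show ?thesis using False by simp
        qed
        have "runs \<omega> select s2 (Suc (1 + 1)) ?Q"
          unfolding select_def
        proof (rule runs_Cond)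
          assume "bval (NEq (NArr 4 (NArr 1 (var 5))) (NArr 4 (NArr 2 (var 5)))) s2"
          then have "\<not> ?sel k" using eq UV k2 by (simp add: bval_NEq)
          then have "?Q (s2\<lparr>nats := store (nats s2) 3 k 0\<rparr>)"
            using fr old k2 sumS by (auto intro!: frame_store_nats simp: store_def less_Suc_eq frame_def)
          then show "runs \<omega> (NAssign 3 (var 5) (NLit 0)) s2 (1 + 1) ?Q"
            by (intro runs_weaken[OF runs_NAssign[where Q = ?Q]]) (auto simp: k2)
        next
          assume "\<not> bval (NEq (NArr 4 (NArr 1 (var 5))) (NArr 4 (NArr 2 (var 5)))) s2"
          then have "?sel k" using eq UV k2 by (simp add: bval_NEq)
          then have "?Q (s2\<lparr>nats := store (nats s2) 3 k 1, reals := store (reals s2) 2 0 (reals s2 2 0 + W k)\<rparr>)"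
            using fr old k2 sumS by (auto simp: store_def less_Suc_eq frame_def)
          then show "runs \<omega> (Seq (NAssign 3 (var 5) (NLit 1)) (RAssign 2 (NLit 0) (RPlus (RArr 2 (NLit 0)) (RArr 0 (var 5))))) s2 (1 + 1) ?Q"
            by (intro runs_Seq runs_NAssign runs_RAssign) (simp add: k2 UV store_other)
        qed
        then show "runs \<omega> select s2 3 ?Q" by (simp add: numeral_3_eq_3)
      qed
    qed
  qed
  then show ?thesis
    unfolding greedy_def greedy_time_def by (intro runs_Seq runs_RAssign) simp
qed

section \<open>Computing the keys, and the complete program\<close>

definition copy_weights :: com where
  "copy_weights = For 5 n_edges (RAssign 1 (var 5) (RArr 0 (var 5)))"

lemma runs_copy_weights:
  assumes inp: "holds_input n m U V W s"
  shows "runs \<omega> copy_weights s (3 * m + 2)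
    (\<lambda>s'. frame {5} {1} s s' \<and> (\<forall>i<m. reals s' 1 i = W i))"
proof -
  let ?I = "\<lambda>k s'. frame {5} {1} s s' \<and> (\<forall>i<k. reals s' 1 i = W i)"
  have "runs \<omega> (For 5 n_edges (RAssign 1 (var 5) (RArr 0 (var 5)))) s (m * (1 + 2) + 2) (?I m)"
  proof (rule runs_For[where I = ?I])
    show "?I 0 (s\<lparr>nats := store (nats s) 5 0 0\<rparr>)" by (auto simp: store_def frame_def)
  next
    fix k s' assume "?I k s'"
    then show "nval n_edges s' = m" using inp by (auto simp: frame_nats holds_input_def)
  next
    fix k s' assume k: "k < m" "?I k s'" "nats s' 5 0 = k"
    then have "reals s' 0 k = W k" using inp by (auto simp: frame_reals holds_input_def)
    then show "runs \<omega> (RAssign 1 (var 5) (RArr 0 (var 5))) s' 1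
        (\<lambda>s'. nats s' 5 0 = k \<and> ?I (Suc k) (s'\<lparr>nats := store (nats s') 5 0 (Suc k)\<rparr>))"
      using k by (intro runs_RAssign) (auto simp: store_def frame_def less_Suc_eq)
  qed
  then show ?thesis unfolding copy_weights_def by (rule runs_weaken) auto
qed

text \<open>The machine cannot multiply naturals; \<open>k\<close> is fixed by the program text, so
  a repeated sum is an expression of bounded size.\<close>

primrec nmul :: "nat \<Rightarrow> nexp \<Rightarrow> nexp" where
  "nmul 0 x = NLit 0"
| "nmul (Suc k) x = NPlus x (nmul k x)"

lemma nval_nmul: "nval (nmul k x) s = k * nval x s"
  by (induction k) auto

definition choose_width :: "nat \<Rightarrow> com" where
  "choose_width N = Seq (Sample 3 (NLit 0)) (RAssign 3 (NLit 0)
     (RTimes (RDiv (RArr 2 (NLit 0)) (RTimes (ROfNat (NLit N)) (ROfNat n_verts)))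
       (RPlus (RLit 1) (RArr 3 (NLit 0)))))"

lemma runs_choose_width:
  assumes "holds_input n m U V W s" "used s = 0"
  shows "runs \<omega> (choose_width N) s 2 (\<lambda>s'. holds_input n m U V W s' \<and>
    reals s' 3 0 = reals s 2 0 / (real N * real n) * (1 + \<omega> 0))"
proof -
  have "runs \<omega> (choose_width N) s (1 + 1) (\<lambda>s'. holds_input n m U V W s' \<and>
    reals s' 3 0 = reals s 2 0 / (real N * real n) * (1 + \<omega> 0))"
    unfolding choose_width_def using assms
    by (intro runs_Seq runs_Sample runs_RAssign) (simp add: store_def holds_input_def)
  then show ?thesis by (rule runs_weaken) auto
qed

definition round_weights :: "nat \<Rightarrow> com" where
  "round_weights N = For 5 n_edges (Seq (RAssign 1 (var 5) (RLit 0))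
     (For 6 (NPlus (nmul N n_verts) (NLit 1))
       (Cond (RLess (RTimes (ROfNat (NPlus (var 6) (NLit 1))) (RArr 3 (NLit 0))) (RArr 0 (var 5)))
         (RAssign 1 (var 5) (RPlus (RArr 1 (var 5)) (RLit 1))) Skip)))"

lemma runs_round_weights:
  assumes inp: "holds_input n m U V W s"
  shows "runs \<omega> (round_weights N) s (m * (1 + ((N * n + 1) * 4 + 2) + 2) + 2)
    (\<lambda>s'. frame {5, 6} {1} s s' \<and> (\<forall>i<m. reals s' 1 i = grid_key (N * n + 1) (reals s 3 0) (W i)))"
proof -
  define K where "K = N * n + 1"
  define g where "g = reals s 3 0"
  let ?I = "\<lambda>k s'. frame {5, 6} {1} s s' \<and> (\<forall>i<k. reals s' 1 i = grid_key K g (W i))"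
  let ?c = "Cond (RLess (RTimes (ROfNat (NPlus (var 6) (NLit 1))) (RArr 3 (NLit 0))) (RArr 0 (var 5)))
         (RAssign 1 (var 5) (RPlus (RArr 1 (var 5)) (RLit 1))) Skip"
  let ?b = "NPlus (nmul N n_verts) (NLit 1)"
  have n: "nats s 0 0 = n" "nats s 0 1 = m" using inp by (auto simp: holds_input_def)
  have "runs \<omega> (For 5 n_edges (Seq (RAssign 1 (var 5) (RLit 0)) (For 6 ?b ?c))) s
      (m * (1 + (K * (Suc 1 + 2) + 2) + 2) + 2) (?I m)"
  proof (rule runs_For[where I = ?I])
    show "?I 0 (s\<lparr>nats := store (nats s) 5 0 0\<rparr>)" by (auto simp: store_def frame_def)
  next
    fix k s' assume "?I k s'"
    then show "nval n_edges s' = m" using n by (auto simp: frame_nats)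
  next
    fix i s' assume i: "i < m" "?I i s'" "nats s' 5 0 = i"
    let ?s = "s'\<lparr>reals := store (reals s') 1 i 0\<rparr>"
    \<comment> \<open>The cap doubles as the loop counter: after \<open>k\<close> rounds cell
      \<open>i\<close> holds the key capped at \<open>k\<close>.\<close>
    let ?J = "\<lambda>k s''. frame {5, 6} {1} s s'' \<and> nats s'' 5 0 = i \<and> (\<forall>j<i. reals s'' 1 j = grid_key K g (W j)) \<and>
      reals s'' 1 i = grid_key k g (W i)"
    let ?Q = "\<lambda>s'. nats s' 5 0 = i \<and> ?I (Suc i) (s'\<lparr>nats := store (nats s') 5 0 (Suc i)\<rparr>)"
    have "runs \<omega> (For 6 ?b ?c) ?s (K * (Suc 1 + 2) + 2) ?Q"
    proof (rule runs_For[where I = ?J])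
      show "?J 0 (?s\<lparr>nats := store (nats ?s) 6 0 0\<rparr>)"
        using i by (auto simp: store_def frame_def grid_key_def)
    next
      fix k s'' assume "?J k s''"
      then show "nval ?b s'' = K" using n by (auto simp: frame_nats nval_nmul K_def)
    next
      fix k s'' assume k: "k < K" "?J k s''" "nats s'' 6 0 = k"
      have v: "reals s'' 3 0 = g" "reals s'' 0 i = W i"
        using k(2) inp i(1) by (auto simp: frame_reals g_def holds_input_def)
      have S: "grid_key (Suc k) g (W i) = grid_key k g (W i) + (if real (Suc k) * g < W i then 1 else 0)"
        by (simp add: grid_key_def)
      show "runs \<omega> ?c s'' (Suc 1) (\<lambda>s'. nats s' 6 0 = k \<and> ?J (Suc k) (s'\<lparr>nats := store (nats s') 6 0 (Suc k)\<rparr>))"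
        using k v S
        by (intro runs_Cond runs_RAssign runs_Skip) (auto simp: store_def frame_def add.commute)
    next
      fix s'' assume "?J K s''"
      then show "?Q s''" by (auto simp: store_def frame_def less_Suc_eq)
    qed
    then show "runs \<omega> (Seq (RAssign 1 (var 5) (RLit 0)) (For 6 ?b ?c)) s' (1 + (K * (Suc 1 + 2) + 2)) ?Q"
      by (intro runs_Seq runs_RAssign) (simp add: i(3))
  qed
  then show ?thesis unfolding round_weights_def K_def g_def by (rule runs_weaken) (auto simp: algebra_simps)
qed

definition mst_program :: "nat \<Rightarrow> com" where
  "mst_program N = Seq copy_weights (Seq greedy (Seq (choose_width N) (Seq (round_weights N) greedy)))"

definition mst_time :: "nat \<Rightarrow> nat \<Rightarrow> nat \<Rightarrow> nat" where
  "mst_time N n m = (3 * m + 2) + (greedy_time n m + (2 +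
     ((m * (1 + ((N * n + 1) * 4 + 2) + 2) + 2) + greedy_time n m)))"

lemma selected_cong:
  "(\<And>i. i < m \<Longrightarrow> \<kappa> i = \<kappa>' i) \<Longrightarrow> i < m \<Longrightarrow> selected m U V \<kappa> i \<longleftrightarrow> selected m U V \<kappa>' i"
proof -
  assume a: "\<And>i. i < m \<Longrightarrow> \<kappa> i = \<kappa>' i" "i < m"
  then have "{j. j < m \<and> before \<kappa> j i} = {j. j < m \<and> before \<kappa>' j i}" by (auto simp: before_def)
  then show ?thesis by (simp add: selected_def)
qed

lemma runs_mst_program:
  fixes \<omega> :: "nat \<Rightarrow> real" and N :: nat
  assumes inp: "holds_input n m U V W s" and u: "used s = 0"
  defines "width \<equiv> (\<Sum>i | i < m \<and> selected m U V W i. W i) / (real N * real n) * (1 + \<omega> 0)"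
  shows "runs \<omega> (mst_program N) s (mst_time N n m)
    (\<lambda>s'. \<forall>i<m. nats s' 3 i = of_bool (selected m U V (\<lambda>i. grid_key (N * n + 1) width (W i)) i))"
  unfolding mst_program_def mst_time_def
proof (rule runs_Seq, rule runs_weaken[OF runs_copy_weights[OF inp] _ order_refl], rule runs_Seq)
  fix s1 assume s1: "frame {5} {1} s s1 \<and> (\<forall>i<m. reals s1 1 i = W i)"
  let ?T = "2 + ((m * (1 + ((N * n + 1) * 4 + 2) + 2) + 2) + greedy_time n m)"
  let ?Q = "\<lambda>s'. \<forall>i<m. nats s' 3 i = of_bool (selected m U V (\<lambda>i. grid_key (N * n + 1) width (W i)) i)"
  have inp1: "holds_input n m U V W s1" by (rule holds_input_frame[OF inp conjunct1[OF s1]]) auto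
  show "runs \<omega> greedy s1 (greedy_time n m)
    (\<lambda>s'. runs \<omega> (Seq (choose_width N) (Seq (round_weights N) greedy)) s' ?T ?Q)"
  proof (rule runs_weaken[OF runs_greedy[OF inp1] _ order_refl], rule runs_Seq)
    fix s2 assume s2: "frame {3, 4, 5, 6, 7, 8, 9} {2} s1 s2 \<and>
      (\<forall>i<m. nats s2 3 i = of_bool (selected m U V (reals s1 1) i)) \<and>
      reals s2 2 0 = (\<Sum>i | i < m \<and> selected m U V (reals s1 1) i. W i)"
    have inp2: "holds_input n m U V W s2" by (rule holds_input_frame[OF inp1 conjunct1[OF s2]]) auto
    have "{i. i < m \<and> selected m U V (reals s1 1) i} = {i. i < m \<and> selected m U V W i}"
      using s1 selected_cong[of m "reals s1 1" W] by blast
    then have w: "reals s2 2 0 / (real N * real n) * (1 + \<omega> 0) = width" using s2 by (simp add: width_def)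
    have u2: "used s2 = 0" using u s1 s2 by (simp add: frame_def)
    show "runs \<omega> (choose_width N) s2 2 (\<lambda>s'. runs \<omega> (Seq (round_weights N) greedy) s'
        ((m * (1 + ((N * n + 1) * 4 + 2) + 2) + 2) + greedy_time n m) ?Q)"
    proof (rule runs_weaken[OF runs_choose_width[OF inp2 u2] _ order_refl], rule runs_Seq)
      fix s3 assume "holds_input n m U V W s3 \<and> reals s3 3 0 = reals s2 2 0 / (real N * real n) * (1 + \<omega> 0)"
      then have inp3: "holds_input n m U V W s3" and w3: "reals s3 3 0 = width" using w by auto
      show "runs \<omega> (round_weights N) s3 (m * (1 + ((N * n + 1) * 4 + 2) + 2) + 2)
          (\<lambda>s'. runs \<omega> greedy s' (greedy_time n m) ?Q)"
      proof (rule runs_weaken[OF runs_round_weights[OF inp3] _ order_refl])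
        fix s4 assume s4: "frame {5, 6} {1} s3 s4 \<and>
          (\<forall>i<m. reals s4 1 i = grid_key (N * n + 1) (reals s3 3 0) (W i))"
        have inp4: "holds_input n m U V W s4" by (rule holds_input_frame[OF inp3 conjunct1[OF s4]]) auto
        show "runs \<omega> greedy s4 (greedy_time n m) ?Q"
          by (rule runs_weaken[OF runs_greedy[OF inp4] _ order_refl])
            (use s4 w3 selected_cong[of m "reals s4 1" "\<lambda>i. grid_key (N * n + 1) width (W i)"] in auto)
      qed
    qed
  qed
qed

section \<open>The approximation algorithm\<close>

lemma holds_input_input_state:
  "holds_input (nverts G) (length (edge_list G)) (\<lambda>k. fst (edge_list G ! k)) (\<lambda>k. snd (edge_list G ! k))
     (\<lambda>k. w (edge_at G k)) (input_state G w)"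
proof -
  have "fst (edge_list G ! k) < nverts G \<and> snd (edge_list G ! k) < nverts G" if "k < length (edge_list G)" for k
    using nth_mem[OF that] by (auto simp: set_edge_list)
  then show ?thesis by (simp add: holds_input_def input_state_def Let_def)
qed

text \<open>Input positions are both the machine's edge names and the tie-break, so
  \<open>before\<close> and \<open>key_order\<close> coincide.\<close>

lemma selected_iff_kruskal:
  assumes G: "connected_graph G" and i: "i < length (edge_list G)"
  shows "selected (length (edge_list G)) (\<lambda>k. fst (edge_list G ! k)) (\<lambda>k. snd (edge_list G ! k))
      (\<lambda>i. key (edge_at G i)) i \<longleftrightarrow> edge_at G i \<in> kruskal (key_order G key) (edges G)"
proof -
  let ?m = "length (edge_list G)"
  have E: "edges G = edge_at G ` {..<?m}" using bij_betw_imp_surj_on[OF edge_at_bij[OF G]] by simp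
  have "key_order G key (edge_at G j) (edge_at G i) \<longleftrightarrow> before (\<lambda>i. key (edge_at G i)) j i" if "j < ?m" for j
    by (simp add: key_order_def before_def edge_index_edge_at[OF G] i that)
  then have "{f \<in> edges G. key_order G key f (edge_at G i)} =
      edge_at G ` {j. j < ?m \<and> before (\<lambda>i. key (edge_at G i)) j i}"
    unfolding E by auto
  then show ?thesis
    using i E by (simp add: selected_def kruskal_def flip: edge_at_def)
qed

lemma runs_mst_program_input:
  assumes G: "connected_graph G"
  shows "runs \<omega> (mst_program N) (input_state G w) (mst_time N (nverts G) (card (edges G)))
    (\<lambda>s'. output_edges G s' =
      rounded_tree (N * nverts G + 1) G w (opt G w / (N * nverts G) * (1 + \<omega> 0)))"
proof -
  let ?m = "length (edge_list G)" and ?n = "nverts G"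
  let ?U = "\<lambda>k. fst (edge_list G ! k)" and ?V = "\<lambda>k. snd (edge_list G ! k)" and ?W = "\<lambda>k. w (edge_at G k)"
  let ?s = "opt G w / (real N * real ?n) * (1 + \<omega> 0)"
  have inj: "inj_on (edge_at G) {..<?m}" and E: "edges G = edge_at G ` {..<?m}"
    using edge_at_bij[OF G] by (auto simp: bij_betw_def)
  have trees: "edge_at G ` {i. i < ?m \<and> selected ?m ?U ?V (\<lambda>i. key (edge_at G i)) i} =
      kruskal (key_order G key) (edges G)" for key
    using selected_iff_kruskal[OF G] kruskal_subset[of "key_order G key" "edges G"] E by auto
  \<comment> \<open>The weight accumulated by the first pass is that of the exact greedy
    tree.\<close>
  have "(\<Sum>i | i < ?m \<and> selected ?m ?U ?V ?W i. ?W i) =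
      sum w (edge_at G ` {i. i < ?m \<and> selected ?m ?U ?V ?W i})"
    by (subst sum.reindex) (auto intro: inj_on_subset[OF inj])
  also have "\<dots> = opt G w" unfolding trees using weight_kruskal_eq_opt[OF G] by (simp add: weight_def)
  finally have o: "(\<Sum>i | i < ?m \<and> selected ?m ?U ?V ?W i. ?W i) = opt G w" .
  have out: "output_edges G s' = rounded_tree (N * ?n + 1) G w ?s"
    if "\<forall>i<?m. nats s' 3 i = of_bool (selected ?m ?U ?V (\<lambda>i. grid_key (N * ?n + 1) ?s (?W i)) i)" for s'
  proof -
    have "output_edges G s' = edge_at G ` {i. i < ?m \<and> selected ?m ?U ?V (\<lambda>i. grid_key (N * ?n + 1) ?s (?W i)) i}"
      using that by (auto simp: output_edges_def)
    then show ?thesis unfolding rounded_tree_def using trees[of "\<lambda>e. grid_key (N * ?n + 1) ?s (w e)"] by simp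
  qed
  have "used (input_state G w) = 0" by (simp add: input_state_def Let_def)
  from runs_mst_program[OF holds_input_input_state this, of \<omega> N, unfolded o]
  show ?thesis
    by (rule runs_weaken) (use out in \<open>auto simp: length_edge_list[OF G]\<close>)
qed

lemma run_output_mst_program:
  assumes "connected_graph G"
  shows "run_output (mst_program N) G w \<omega> =
    rounded_tree (N * nverts G + 1) G w (opt G w / (N * nverts G) * (1 + \<omega> 0))"
proof -
  obtain t s where s: "exec \<omega> (mst_program N) (input_state G w) t s"
    "output_edges G s = rounded_tree (N * nverts G + 1) G w (opt G w / (N * nverts G) * (1 + \<omega> 0))"
    using runs_mst_program_input[OF assms, of \<omega> N w] unfolding runs_def by blast
  have "final_state (mst_program N) G w \<omega> = s"
    unfolding final_state_def using s(1) exec_deterministic[OF s(1)] by blast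
  then show ?thesis using s(2) by (simp add: run_output_def)
qed

text \<open>The cubic term stems from rebuilding the components for every edge. The coefficient is 5
  + 26 + 2 + (11 + 4 N) + 26; lower powers are absorbed because n + m is at least 1.\<close>

lemma mst_time_le:
  assumes "0 < n" shows "mst_time N n m \<le> (70 + 4 * N) * (n + m) ^ 3"
proof -
  define x where "x = n + m"
  have x: "1 \<le> x" "n \<le> x" "m \<le> x" using assms by (auto simp: x_def)
  have p: "1 \<le> x ^ 3" "x \<le> x ^ 3" "x * x \<le> x ^ 3"
    using x(1) by (auto simp: power3_eq_cube)
  have "greedy_time n m = 3 + m * (3 * n + 9 + m * (4 * n + 7))"
    by (simp add: greedy_time_def algebra_simps)
  also have "\<dots> \<le> 3 + x * (3 * x + 9 * x + x * (4 * x + 7 * x))"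
    using x by (intro add_mono mult_mono) auto
  also have "\<dots> = 3 + 12 * (x * x) + 11 * x ^ 3" by (simp add: algebra_simps power3_eq_cube)
  also have "\<dots> \<le> 26 * x ^ 3" using p by linarith
  finally have g: "greedy_time n m \<le> 26 * x ^ 3" .
  have "m * (1 + ((N * n + 1) * 4 + 2) + 2) + 2 = m * (9 + 4 * (N * n)) + 2" by (simp add: algebra_simps)
  also have "\<dots> \<le> x * (9 * x + 4 * (N * x)) + 2"
    using x by (intro add_mono mult_mono) auto
  also have "\<dots> = (9 + 4 * N) * (x * x) + 2" by (simp add: algebra_simps)
  also have "\<dots> \<le> (9 + 4 * N) * x ^ 3 + 2 * x ^ 3" using p by (intro add_mono mult_left_mono) auto
  finally have r: "m * (1 + ((N * n + 1) * 4 + 2) + 2) + 2 \<le> (9 + 4 * N) * x ^ 3 + 2 * x ^ 3" .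
  have c: "3 * m + 2 \<le> 5 * x ^ 3" "2 \<le> 2 * x ^ 3" using p x by linarith+
  have "mst_time N n m \<le> 5 * x ^ 3 + (26 * x ^ 3 + (2 * x ^ 3 + (((9 + 4 * N) * x ^ 3 + 2 * x ^ 3) + 26 * x ^ 3)))"
    unfolding mst_time_def by (rule add_mono[OF c(1) add_mono[OF g add_mono[OF c(2) add_mono[OF r g]]]])
  also have "\<dots> = (70 + 4 * N) * x ^ 3" by (simp add: algebra_simps)
  finally show ?thesis by (simp add: x_def)
qed

lemma runs_in_poly_time_mst_program: "runs_in_poly_time (mst_program N)"
  unfolding runs_in_poly_time_def
proof (rule exI[of _ "70 + 4 * N"], rule exI[of _ 3], intro allI impI ballI)
  fix G :: graph and w and \<omega> :: "nat \<Rightarrow> real" assume G: "connected_graph G"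
  then have "0 < nverts G" by (simp add: connected_graph_def)
  then show "\<exists>t s. exec \<omega> (mst_program N) (input_state G w) t s \<and>
      t \<le> (70 + 4 * N) * (nverts G + card (edges G)) ^ 3"
    using runs_mst_program_input[OF G, of \<omega> N w] mst_time_le[of "nverts G" N "card (edges G)"]
    unfolding runs_def by (meson le_trans)
qed

definition mst_algorithm :: "nat \<Rightarrow> algorithm" where
  "mst_algorithm N G w = (SOME p. tree_law N G w p)"

lemma tree_law_mst_algorithm: "connected_graph G \<Longrightarrow> tree_law N G w (mst_algorithm N G w)"
  unfolding mst_algorithm_def by (rule someI_ex[OF tree_law_exists])

lemma poly_time_mst_algorithm: "poly_time_algorithm (mst_algorithm N)"
  unfolding poly_time_algorithm_def implements_def
proof (intro exI[of _ "mst_program N"] conjI allI impI runs_in_poly_time_mst_program)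
  fix G w assume G: "connected_graph G"
  have r: "run_output (mst_program N) G w = (\<lambda>\<omega>. rounded_tree (N * nverts G + 1) G w
      (opt G w / (N * nverts G) * (1 + \<omega> 0)))"
    by (intro ext run_output_mst_program[OF G])
  show "run_output (mst_program N) G w \<in> random_tape \<rightarrow>\<^sub>M count_space UNIV"
    unfolding r by (rule measurable_tree_tape[OF G])
  show "distr random_tape (count_space UNIV) (run_output (mst_program N) G w) = measure_pmf (mst_algorithm N G w)"
    unfolding r using tree_law_mst_algorithm[OF G, of N w] by (simp add: tree_law_def)
qed

text \<open>A supported tree has positive probability, so it arises from an actual tape. The
  approximation guarantee thus holds for every supported outcome and not merely almost
  surely.\<close>

lemma tree_law_support:
  assumes G: "connected_graph G" and p: "tree_law N G w p" and T: "T \<in> set_pmf p"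
  obtains u where "0 \<le> u" "u \<le> 1"
    "T = rounded_tree (N * nverts G + 1) G w (opt G w / (N * nverts G) * (1 + u))"
proof -
  let ?X = "\<lambda>\<omega>. rounded_tree (N * nverts G + 1) G w (opt G w / (N * nverts G) * (1 + \<omega> 0))"
  have "0 \<noteq> measure (measure_pmf p) {T}" using T by (simp add: set_pmf_iff pmf.rep_eq)
  also have "measure (measure_pmf p) {T} = measure random_tape (?X -` {T} \<inter> space random_tape)"
    unfolding p[unfolded tree_law_def] by (rule measure_distr[OF measurable_tree_tape[OF G]]) simp
  finally have "?X -` {T} \<inter> space random_tape \<noteq> {}" by (metis measure_empty)
  then obtain \<omega> where \<omega>: "\<omega> \<in> space random_tape" "?X \<omega> = T" by auto
  show ?thesis using random_tape_space[OF \<omega>(1), of 0] \<omega>(2) by (intro that[of "\<omega> 0"]) auto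
qed

lemma approximates_mst_algorithm:
  assumes N: "0 < N" and \<epsilon>: "2 / real N \<le> \<epsilon>"
  shows "approximates_mst (1 + \<epsilon>) (mst_algorithm N)"
  unfolding approximates_mst_def
proof (intro allI impI ballI conjI)
  fix G w T assume G: "connected_graph G" and w: "w \<in> weight_space G" and T: "T \<in> set_pmf (mst_algorithm N G w)"
  let ?n = "nverts G" and ?K = "N * nverts G + 1"
  define a where "a = opt G w / (N * ?n)"
  obtain u where u: "0 \<le> u" "u \<le> 1" "T = rounded_tree ?K G w (a * (1 + u))"
    unfolding a_def by (rule tree_law_support[OF G tree_law_mst_algorithm[OF G] T])
  then show "spanning_tree G T" using spanning_tree_rounded_tree[OF G] by simp
  have n: "0 < ?n" using G by (simp add: connected_graph_def)
  note o = opt_nonneg[OF G w]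
  have a: "0 \<le> a" "a * (N * ?n) = opt G w" using o N n by (auto simp: a_def)
  \<comment> \<open>For positive \<open>a\<close> the extra 1 in the cap adds \<open>a\<close> to a
    N n = opt and makes the inequality strict.\<close>
  have "opt G w < ?K * (a * (1 + u)) \<or> a * (1 + u) = 0 \<and> opt G w = 0"
  proof (cases "a = 0")
    case False
    then have "0 < a" using a by simp
    have "opt G w < a * ?K" using a(2) \<open>0 < a\<close> by (simp add: distrib_left)
    also have "\<dots> = a * ?K * 1" by simp
    also have "\<dots> \<le> a * ?K * (1 + u)" using a(1) u(1) by (intro mult_left_mono) auto
    finally show ?thesis by (simp add: mult_ac)
  qed (use a in simp)
  then have "weight w T \<le> opt G w + ?n * (a * (1 + u))"
    unfolding u(3) using a(1) u(1) by (intro weight_rounded_tree[OF G w]) auto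
  also have "\<dots> \<le> opt G w + ?n * (a * 2)"
    using a(1) u(2) by (intro add_left_mono mult_left_mono) auto
  also have "?n * (a * 2) = 2 / N * opt G w" using N n by (simp add: a_def)
  also have "\<dots> \<le> \<epsilon> * opt G w" using \<epsilon> o by (rule mult_right_mono)
  finally show "weight w T \<le> (1 + \<epsilon>) * opt G w" by (simp add: algebra_simps)
qed

theorem theorem7p2:
  fixes \<epsilon>\<^sub>0 :: real
  assumes "0 < \<epsilon>\<^sub>0"
  shows "\<exists>C>0. \<forall>\<epsilon>. 0 < \<epsilon> \<and> \<epsilon> \<le> \<epsilon>\<^sub>0 \<longrightarrow>
    (\<exists>A. poly_time_algorithm A \<and> approximates_mst (1 + \<epsilon>) A \<and>
      (\<forall>G w. connected_graph G \<longrightarrow> w \<in> weight_space G \<longrightarrow>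
        pointwise_lipschitz_u A G w \<le> ennreal (C * (real (nverts G) / \<epsilon>)) / ennreal (opt G w)))"
proof (intro exI[of _ "16 + 12 * \<epsilon>\<^sub>0"] conjI allI impI)
  show "0 < 16 + 12 * \<epsilon>\<^sub>0" using assms by simp
  fix \<epsilon> assume "0 < \<epsilon> \<and> \<epsilon> \<le> \<epsilon>\<^sub>0"
  then have \<epsilon>: "0 < \<epsilon>" "\<epsilon> \<le> \<epsilon>\<^sub>0" by auto
  define N where "N = nat \<lceil>2 / \<epsilon>\<rceil>"
  have "0 < 2 / \<epsilon>" using \<epsilon> by simp
  then have N: "2 / \<epsilon> \<le> N" "N \<le> 2 / \<epsilon> + 1" "0 < N" unfolding N_def by linarith+
  have N\<epsilon>: "2 / real N \<le> \<epsilon>" using N \<epsilon> by (simp add: field_simps)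
  \<comment> \<open>Rounding 2 / \<epsilon> up adds at most 1 to \<open>N\<close>, so (8 N + 4)
    \<epsilon> is at most 16 + 12 \<epsilon>. The part 12 \<epsilon> is why the constant involves
    \<open>\<epsilon>\<^sub>0\<close>.\<close>
  have "N * \<epsilon> \<le> 2 + \<epsilon>" using N(2) \<epsilon> by (simp add: field_simps)
  then have "(8 * N + 4) * \<epsilon> \<le> 16 + 12 * \<epsilon>\<^sub>0" using \<epsilon> by (simp add: algebra_simps)
  then have C: "8 * N + 4 \<le> (16 + 12 * \<epsilon>\<^sub>0) / \<epsilon>" using \<epsilon>(1) by (simp add: pos_le_divide_eq)
  show "\<exists>A. poly_time_algorithm A \<and> approximates_mst (1 + \<epsilon>) A \<and>
      (\<forall>G w. connected_graph G \<longrightarrow> w \<in> weight_space G \<longrightarrow> pointwise_lipschitz_u A G w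
        \<le> ennreal ((16 + 12 * \<epsilon>\<^sub>0) * (real (nverts G) / \<epsilon>)) / ennreal (opt G w))"
  proof (intro exI[of _ "mst_algorithm N"] conjI allI impI)
    show "poly_time_algorithm (mst_algorithm N)" by (rule poly_time_mst_algorithm)
    show "approximates_mst (1 + \<epsilon>) (mst_algorithm N)" by (rule approximates_mst_algorithm[OF N(3) N\<epsilon>])
    fix G w assume G: "connected_graph G" and w: "w \<in> weight_space G"
    let ?R = "(16 + 12 * \<epsilon>\<^sub>0) * (real (nverts G) / \<epsilon>)"
    have n: "0 < nverts G" using G by (simp add: connected_graph_def)
    have R: "0 < ?R" using assms \<epsilon> n by simp
    show "pointwise_lipschitz_u (mst_algorithm N) G w \<le> ennreal ?R / ennreal (opt G w)"
    proof (cases "opt G w = 0")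
      \<comment> \<open>The right-hand side is a positive number divided by 0, which is infinite in
        \<open>ennreal\<close>.\<close>
      case True
      then show ?thesis using assms \<epsilon> n by simp
    next
      case False
      then have o: "0 < opt G w" using opt_nonneg[OF G w] by simp
      have "pointwise_lipschitz_u (mst_algorithm N) G w \<le> ennreal ((8 * N + 4) * nverts G / opt G w)"
        by (rule pointwise_lipschitz_tree_law[OF G w N(3) o]) (rule tree_law_mst_algorithm[OF G])
      also have "\<dots> \<le> ennreal (?R / opt G w)"
        using mult_right_mono[OF C, of "nverts G"] o
        by (intro ennreal_leI divide_right_mono) auto
      also have "\<dots> = ennreal ?R / ennreal (opt G w)"
        using R o by (intro divide_ennreal[symmetric]) auto
      finally show ?thesis .
    qed
  qed
qed

end
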